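(* Let $\sigma_t,\tau_t,\delta_t$ ($t=1,2,4$) be the automorphisms of $F_2$ described in the context, and let $\widetilde{\mathcal U}:=\delta_t^*(\mathcal U)$ with $\mathcal U:=(e_1,1^* )+(e_2,2^* )$ (so $\widetilde{\mathcal U}$ depends on $t$). For any positive integer $n$: (1) $\sigma_1^{*\,n}(\widetilde{\mathcal U})\in\mathcal G^*_{\sigma_1}$; (2) $\sigma_t^{*\,2n}(\widetilde{\mathcal U})\in\mathcal G^*_{\sigma_t}+e_1$ for $t=2,4$. Moreover, $\sigma_t^{*\,n}(\widetilde{\mathcal U})$, $t=1,2,4$, are connected.
   Context: Let $F_2$ be the free group on the letters $1,2$, and let $f:F_2\to\mathbb Z^2$ be the homomorphism with $f(i^{\pm1})=\pm e_i$ ($e_1,e_2$ the standard basis; $f$ of the empty word is $0$). For an endomorphism $\sigma$ of $F_2$, $A_\sigma$ is the $2\times2$ matrix with columns $f(\sigma(1)),f(\sigma(2))$. The automorphisms ($2^{k}$ with $k<0$ means $(2^{-1})^{|k|}$; $a$ is an integer): - $t=1$, $a\ge3$: $\sigma_1:1\mapsto2,\ 2\mapsto2^{a-2}1^{-1}22$; $\tau_1:1\mapsto2^{a-3}12,\ 2\mapsto2^{a-2}12$; $\delta_1:1\mapsto21^{-1},\ 2\mapsto2$. - $t=2$, $a\le-3$: $\sigma_2:1\mapsto2,\ 2\mapsto1^{-1}2^{a}$; $\tau_2:1\mapsto1^{-1}2^{a+2},\ 2\mapsto1^{-1}2^{a+1}$; $\delta_2:1\mapsto2^{-1}1,\ 2\mapsto2$.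 - $t=4$, $a\le-1$: $\sigma_4:1\mapsto2,\ 2\mapsto12^{a}$; $\tau_4:1\mapsto2^{-1},\ 2\mapsto1^{-1}2^{a}$; $\delta_4:1\mapsto1^{-1},\ 2\mapsto2$. In each case $\sigma_t=\delta_t^{-1}\circ\tau_t\circ\delta_t$. Let $\lambda_t$ be the eigenvalue of $A_{\sigma_t}$ with $|\lambda_t|>1$ (the other one has modulus $<1$); $\lambda_1>1$, $\lambda_2<-1$, $\lambda_4<-1$. $\mathcal G^*$ is the free $\mathbb Z$-module with basis the symbols $(x,i^* )$, $x\in\mathbb Z^2$, $i\in\{1,2\}$. The symbol $(x,1^* )$ is identified with the unit segment $\{x+se_2:0\le s\le1\}$ and $(x,2^* )$ with $\{x+se_1:0\le s\le1\}$ (a negative coefficient means reversed orientation). An element of $\mathcal G^*$ is called connected if the union of the segments occurring in it with nonzero coefficient is a connected subset of $\mathbb R^2$. For an endomorphism $\sigma$ of $F_2$ with $\det A_\sigma=\pm1$ and $\sigma(j)=w^{(j)}_1\cdots w^{(j)}_{l^{(j)}}$ (reduced word), put $S^{(j)}_k=w^{(j)}_{k+1}\cdots w^{(j)}_{l^{(j)}}$. The tiling substitution $\sigma^*:\mathcal G^*\to\mathcal G^*$ is the $\mathbb Z$-linear map $$\sigma^*(x,i^* )=\sum_{j\in\{1,2\}}\Big\{\sum_{k:\,w^{(j)}_k=i}\big(A_\sigma^{-1}(x+f(S^{(j)}_k)),j^*\big)-\sum_{k:\,w^{(j)}_k=i^{-1}}\big(A_\sigma^{-1}(x+f(w^{(j)}_kS^{(j)}_k)),j^*\big)\Big\},$$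 and $\sigma^{*\,n}$ is its $n$-th iterate. Let $v_{\sigma_1}=(1,\lambda_1)$ and $v_{\sigma_t}=(-1,-\lambda_t)$ for $t=2,4$ (row eigenvectors of $A_{\sigma_t}$ for $\lambda_t$); $\langle\cdot,\cdot\rangle$ is the standard inner product. Define $S_{\sigma_1}=\{(x,i^* ):\langle x,v_{\sigma_1}\rangle>0,\ \langle x-e_i,v_{\sigma_1}\rangle\le0\}$; and for $\sigma=\sigma_2,\sigma_4$, $S_\sigma$ is the set consisting of the $(x,1^* )$ with $\langle x,v_\sigma\rangle>0$, $\langle x+e_1,v_\sigma\rangle\le0$, and the $(x,2^* )$ with $\langle x+e_1,v_\sigma\rangle>0$, $\langle x+e_1-e_2,v_\sigma\rangle\le0$ (always $x\in\mathbb Z^2$). $\mathcal G^*_\sigma$ is the set of finite sums $\sum_k n_k(x_k,i_k^* )$ with $n_k\in\{-1,1\}$ and the $(x_k,i_k^* )\in S_\sigma$ pairwise distinct. For $y\in\mathbb Z^2$, $\mathcal G^*_\sigma+y=\{\sum_k n_k(x_k+y,i_k^* ):\sum_k n_k(x_k,i_k^* )\in\mathcal G^*_\sigma\}$. *)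

theory Defs
  imports
    "HOL-Analysis.Analysis"
    "HOL-Library.Poly_Mapping"
    "HOL-Algebra.Group"
begin

text \<open>The numeral type \<^typ>\<open>2\<close> indexes letters as well as coordinates; its elements are
  \<open>1\<close> and \<open>2\<close> (where \<open>2 = 0\<close>). The letter \<open>i\<close> is \<open>(i, True)\<close> and its inverse is \<open>(i, False)\<close>.\<close>

type_synonym letter = "2 \<times> bool"
type_synonym word = "letter list"

definition inv_letter :: "letter \<Rightarrow> letter" where
  "inv_letter x = (fst x, \<not> snd x)"

definition inv_word :: "word \<Rightarrow> word" where
  "inv_word w = rev (map inv_letter w)"

definition reduced :: "word \<Rightarrow> bool" where
  "reduced w \<longleftrightarrow> successively (\<lambda>x y. y \<noteq> inv_letter x) w"

definition cancel_cons :: "letter \<Rightarrow> word \<Rightarrow> word" where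
  "cancel_cons x w = (case w of [] \<Rightarrow> [x] | y # ys \<Rightarrow> if y = inv_letter x then ys else x # w)"

definition reduce :: "word \<Rightarrow> word" where
  "reduce w = foldr cancel_cons w []"

definition F2 :: "word monoid" where
  "F2 = \<lparr>carrier = {w. reduced w}, monoid.mult = (\<lambda>u v. reduce (u @ v)), one = []\<rparr>"

abbreviation gen :: "2 \<Rightarrow> word" where
  "gen i \<equiv> [(i, True)]"

abbreviation gen_inv :: "2 \<Rightarrow> word" where
  "gen_inv i \<equiv> [(i, False)]"

definition gen_pow :: "2 \<Rightarrow> int \<Rightarrow> word" where
  "gen_pow i k = replicate (nat \<bar>k\<bar>) (i, 0 \<le> k)"

definition subst_letters :: "(2 \<Rightarrow> word) \<Rightarrow> word \<Rightarrow> word" where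
  "subst_letters g w = concat (map (\<lambda>x. if snd x then g (fst x) else inv_word (g (fst x))) w)"

definition endo :: "word \<Rightarrow> word \<Rightarrow> word \<Rightarrow> word" where
  "endo u v w = reduce (subst_letters (\<lambda>i. if i = 1 then u else v) w)"

lemma inv_letter_inv_letter [simp]: "inv_letter (inv_letter x) = x"
  by (simp add: inv_letter_def)

lemma inv_letter_neq [simp]: "inv_letter x \<noteq> x" "x \<noteq> inv_letter x"
  by (auto simp: inv_letter_def prod_eq_iff)

lemma inv_word_Nil [simp]: "inv_word [] = []"
  and inv_word_Cons [simp]: "inv_word (x # w) = inv_word w @ [inv_letter x]"
  and inv_word_append [simp]: "inv_word (u @ v) = inv_word v @ inv_word u"
  by (simp_all add: inv_word_def)

lemma inv_word_inv_word [simp]: "inv_word (inv_word w) = w"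
  by (induction w) auto

lemma reduced_Nil [simp]: "reduced []"
  and reduced_single [simp]: "reduced [x]"
  and reduced_Cons2 [simp]: "reduced (x # y # w) \<longleftrightarrow> y \<noteq> inv_letter x \<and> reduced (y # w)"
  by (simp_all add: reduced_def)

lemma reduced_ConsD: "reduced (x # w) \<Longrightarrow> reduced w"
  by (cases w) auto

lemma reduced_cancel_cons: "reduced w \<Longrightarrow> reduced (cancel_cons x w)"
  by (cases w) (auto simp: cancel_cons_def dest: reduced_ConsD)

lemma cancel_cons_inverse: "reduced w \<Longrightarrow> cancel_cons x (cancel_cons (inv_letter x) w) = w"
  by (cases w rule: remdups_adj.cases) (auto simp: cancel_cons_def)

lemma cancel_cons_inverse': "reduced w \<Longrightarrow> cancel_cons (inv_letter x) (cancel_cons x w) = w"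
  using cancel_cons_inverse [of w "inv_letter x"] by simp

lemma reduced_foldr: "reduced w \<Longrightarrow> reduced (foldr cancel_cons u w)"
  by (induction u) (auto intro: reduced_cancel_cons)

lemma reduced_reduce: "reduced (reduce w)"
  by (simp add: reduce_def reduced_foldr)

lemma reduce_reduced: "reduced w \<Longrightarrow> reduce w = w"
proof (induction w)
  case (Cons x w)
  then have "reduce w = w" by (blast dest: reduced_ConsD)
  with Cons.prems show ?case
    by (cases w) (auto simp: reduce_def cancel_cons_def)
qed (simp add: reduce_def)

lemma foldr_cancel_cons:
  assumes "reduced w"
  shows "foldr cancel_cons (cancel_cons x u) w = cancel_cons x (foldr cancel_cons u w)"
proof (cases u)
  case (Cons y ys)
  have "cancel_cons x (cancel_cons (inv_letter x) (foldr cancel_cons ys w)) = foldr cancel_cons ys w"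
    by (intro cancel_cons_inverse reduced_foldr assms)
  moreover have "cancel_cons x u = (if y = inv_letter x then ys else x # u)"
    by (simp add: Cons cancel_cons_def)
  ultimately show ?thesis by (simp add: Cons)
qed (simp add: cancel_cons_def [of x "[]"])

lemma foldr_reduce: "reduced w \<Longrightarrow> foldr cancel_cons (reduce u) w = foldr cancel_cons u w"
  by (induction u) (simp_all add: reduce_def foldr_cancel_cons)

lemma reduce_append: "reduce (u @ v) = foldr cancel_cons u (reduce v)"
  by (simp add: reduce_def)

lemma reduce_append_left [simp]: "reduce (reduce u @ v) = reduce (u @ v)"
  by (simp add: reduce_append foldr_reduce reduced_reduce)

lemma reduce_append_right [simp]: "reduce (u @ reduce v) = reduce (u @ v)"
  by (simp add: reduce_append reduce_reduced reduced_reduce)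

lemma foldr_inv_word: "reduced w \<Longrightarrow> foldr cancel_cons (inv_word u) (foldr cancel_cons u w) = w"
  by (induction u arbitrary: w) (auto simp: cancel_cons_inverse' reduced_foldr)

lemma foldr_inv_word': "reduced w \<Longrightarrow> foldr cancel_cons u (foldr cancel_cons (inv_word u) w) = w"
  using foldr_inv_word [of w "inv_word u"] by simp

lemma reduced_inv_word: "reduced w \<Longrightarrow> reduced (inv_word w)"
  unfolding reduced_def inv_word_def successively_rev successively_map
  by (erule successively_mono) (auto simp: inv_letter_def prod_eq_iff)

lemma group_F2: "group F2"
proof (rule groupI)
  fix w assume "w \<in> carrier F2"
  then have "reduced (inv_word w)" "reduce (inv_word w @ w) = []"
    using foldr_inv_word [of "[]" w] reduced_inv_word by (auto simp: F2_def reduce_def)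
  then show "\<exists>y\<in>carrier F2. y \<otimes>\<^bsub>F2\<^esub> w = \<one>\<^bsub>F2\<^esub>"
    by (auto simp: F2_def)
qed (auto simp: F2_def reduced_reduce reduce_reduced)

lemma subst_letters_append [simp]:
  "subst_letters g (u @ v) = subst_letters g u @ subst_letters g v"
  by (simp add: subst_letters_def)

lemma foldr_subst_letters_reduce:
  "reduced w \<Longrightarrow>
    foldr cancel_cons (subst_letters g (reduce u)) w = foldr cancel_cons (subst_letters g u) w"
proof (induction u)
  case (Cons x u)
  have *: "foldr cancel_cons (subst_letters g (cancel_cons x v)) w
      = foldr cancel_cons (subst_letters g (x # v)) w" for v
    using Cons.prems
    by (cases v)
      (auto simp: cancel_cons_def subst_letters_def inv_letter_def
        foldr_inv_word foldr_inv_word' reduced_foldr)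
  have "reduce (x # u) = cancel_cons x (reduce u)"
    by (simp add: reduce_def)
  then show ?case
    using * [of "reduce u"] Cons by (simp add: subst_letters_def)
qed (simp add: reduce_def)

lemma endo_append: "endo u v (w @ w') = reduce (endo u v w @ endo u v w')"
  by (simp add: endo_def)

lemma endo_reduce [simp]: "endo u v (reduce w) = endo u v w"
  using foldr_subst_letters_reduce [of "[]"] by (simp add: endo_def reduce_def)

lemma endo_hom: "endo u v \<in> hom F2 F2"
  by (auto simp: hom_def F2_def reduced_reduce endo_def)
     (metis endo_def endo_reduce subst_letters_append)

lemma endo_gen:
  assumes "reduced u" "reduced v"
  shows "endo u v (gen 1) = u" "endo u v (gen 2) = v"
  using assms by (simp_all add: endo_def subst_letters_def reduce_reduced)


definition sigma1 :: "int \<Rightarrow> word \<Rightarrow> word" where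
  "sigma1 a = endo (gen 2) (gen_pow 2 (a - 2) @ gen_inv 1 @ gen 2 @ gen 2)"

definition tau1 :: "int \<Rightarrow> word \<Rightarrow> word" where
  "tau1 a = endo (gen_pow 2 (a - 3) @ gen 1 @ gen 2) (gen_pow 2 (a - 2) @ gen 1 @ gen 2)"

definition delta1 :: "word \<Rightarrow> word" where
  "delta1 = endo (gen 2 @ gen_inv 1) (gen 2)"

definition sigma2 :: "int \<Rightarrow> word \<Rightarrow> word" where
  "sigma2 a = endo (gen 2) (gen_inv 1 @ gen_pow 2 a)"

definition tau2 :: "int \<Rightarrow> word \<Rightarrow> word" where
  "tau2 a = endo (gen_inv 1 @ gen_pow 2 (a + 2)) (gen_inv 1 @ gen_pow 2 (a + 1))"

definition delta2 :: "word \<Rightarrow> word" where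
  "delta2 = endo (gen_inv 2 @ gen 1) (gen 2)"

definition sigma4 :: "int \<Rightarrow> word \<Rightarrow> word" where
  "sigma4 a = endo (gen 2) (gen 1 @ gen_pow 2 a)"

definition tau4 :: "int \<Rightarrow> word \<Rightarrow> word" where
  "tau4 a = endo (gen_inv 2) (gen_inv 1 @ gen_pow 2 a)"

definition delta4 :: "word \<Rightarrow> word" where
  "delta4 = endo (gen_inv 1) (gen 2)"

definition abelianize :: "word \<Rightarrow> int ^ 2" where
  "abelianize w = (\<Sum>x\<leftarrow>w. if snd x then axis (fst x) 1 else - axis (fst x) 1)"

definition incidence_matrix :: "(word \<Rightarrow> word) \<Rightarrow> int ^ 2 ^ 2" where
  "incidence_matrix \<sigma> = (\<chi> i j. abelianize (\<sigma> (gen j)) $ i)"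

type_synonym face = "(int ^ 2) \<times> 2"
type_synonym chain = "face \<Rightarrow>\<^sub>0 int"

text \<open>With positions counted from 0, the suffix written \<open>S\<^sub>k\<close> is \<^term>\<open>drop (Suc k) w\<close>, and the
  letter at \<open>k\<close> followed by it is \<^term>\<open>drop k w\<close>. The inverse matrix is taken over the integers, so
  the definition is meaningful only for endomorphisms whose incidence matrix is unimodular.\<close>

definition dual_face :: "(word \<Rightarrow> word) \<Rightarrow> face \<Rightarrow> chain" where
  "dual_face \<sigma> = (\<lambda>(x, i). \<Sum>j\<in>UNIV. let w = \<sigma> (gen j); B = matrix_inv (incidence_matrix \<sigma>) in
      (\<Sum>k | k < length w \<and> w ! k = (i, True).
          frag_of (B *v (x + abelianize (drop (Suc k) w)), j))
    - (\<Sum>k | k < length w \<and> w ! k = (i, False).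
          frag_of (B *v (x + abelianize (drop k w)), j)))"

definition dual_subst :: "(word \<Rightarrow> word) \<Rightarrow> chain \<Rightarrow> chain" where
  "dual_subst \<sigma> = frag_extend (dual_face \<sigma>)"

definition unit_chain :: chain where
  "unit_chain = frag_of (axis 1 1, 1) + frag_of (axis 2 1, 2)"

definition of_int_vec :: "int ^ 'n \<Rightarrow> real ^ 'n" where
  "of_int_vec x = (\<chi> i. of_int (x $ i))"

text \<open>The face \<open>(x, i)\<close> is the unit segment at \<open>x\<close> orthogonal to the \<open>i\<close>-th axis. Orientation
  is carried by the sign of the coefficient and plays no role in connectedness.\<close>

definition segment :: "face \<Rightarrow> (real ^ 2) set" where
  "segment = (\<lambda>(x, i). {of_int_vec x + s *\<^sub>R axis (if i = 1 then 2 else 1) 1 | s. 0 \<le> s \<and> s \<le> 1})"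

definition connected_chain :: "chain \<Rightarrow> bool" where
  "connected_chain g \<longleftrightarrow> connected (\<Union>b\<in>Poly_Mapping.keys g. segment b)"

definition eigenvalue :: "int ^ 2 ^ 2 \<Rightarrow> real \<Rightarrow> bool" where
  "eigenvalue A l \<longleftrightarrow> (\<exists>v. v \<noteq> 0 \<and> (\<chi> i j. of_int (A $ i $ j)) *v v = l *s v)"

text \<open>The description is well defined for the matrices used below, see
  \<open>ex1_expanding_eigenvalue_sigma\<close>.\<close>

definition expanding_eigenvalue :: "int ^ 2 ^ 2 \<Rightarrow> real" where
  "expanding_eigenvalue A = (THE l. eigenvalue A l \<and> \<bar>l\<bar> > 1)"

definition faces_pos :: "real ^ 2 \<Rightarrow> face set" where
  "faces_pos v = {(x, i). of_int_vec x \<bullet> v > 0 \<and> of_int_vec (x - axis i 1) \<bullet> v \<le> 0}"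

definition faces_neg :: "real ^ 2 \<Rightarrow> face set" where
  "faces_neg v =
     {(x, 1) | x. of_int_vec x \<bullet> v > 0 \<and> of_int_vec (x + axis 1 1) \<bullet> v \<le> 0}
   \<union> {(x, 2) | x. of_int_vec (x + axis 1 1) \<bullet> v > 0 \<and> of_int_vec (x + axis 1 1 - axis 2 1) \<bullet> v \<le> 0}"

text \<open>The normal vector is \<open>(1, \<lambda>)\<close>, resp. \<open>(- 1, - \<lambda>)\<close>, a row eigenvector of the incidence matrix.\<close>

definition faces1 :: "int \<Rightarrow> face set" where
  "faces1 a = faces_pos (vector [1, expanding_eigenvalue (incidence_matrix (sigma1 a))])"

definition faces2 :: "int \<Rightarrow> face set" where
  "faces2 a = faces_neg (vector [- 1, - expanding_eigenvalue (incidence_matrix (sigma2 a))])"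

definition faces4 :: "int \<Rightarrow> face set" where
  "faces4 a = faces_neg (vector [- 1, - expanding_eigenvalue (incidence_matrix (sigma4 a))])"

definition simple_chains :: "face set \<Rightarrow> chain set" where
  "simple_chains S =
     {\<Sum>b\<in>B. frag_cmul (n b) (frag_of b) | B n. finite B \<and> B \<subseteq> S \<and> (\<forall>b\<in>B. n b \<in> {- 1, 1})}"

definition translate_chain :: "int ^ 2 \<Rightarrow> chain \<Rightarrow> chain" where
  "translate_chain y = frag_extend (\<lambda>(x, i). frag_of (x + y, i))"

lemma subst_letters_Nil [simp]: "subst_letters g [] = []"
  and subst_letters_Cons [simp]: "subst_letters g (x # w) =
    (if snd x then g (fst x) else inv_word (g (fst x))) @ subst_letters g w"
  by (simp_all add: subst_letters_def)

lemma inv_word_subst_letters: "inv_word (subst_letters g w) = subst_letters g (inv_word w)"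
  by (induction w) (auto simp: inv_letter_def)

lemma subst_letters_subst_letters:
  "subst_letters g (subst_letters h w) = subst_letters (\<lambda>i. subst_letters g (h i)) w"
  by (induction w) (auto simp: inv_word_subst_letters)

lemma reduce_inv_word: "reduce (inv_word w) = inv_word (reduce w)"
proof -
  interpret group F2 by (rule group_F2)
  have inv: "inv\<^bsub>F2\<^esub> u = inv_word u" if "reduced u" for u
    using that foldr_inv_word [of "[]" u] reduced_inv_word
    by (intro inv_equality) (auto simp: F2_def reduce_def)
  have "reduce (inv_word w) \<otimes>\<^bsub>F2\<^esub> reduce w = \<one>\<^bsub>F2\<^esub>"
    using foldr_inv_word [of "[]" w] by (simp add: F2_def) (simp add: reduce_def)
  then have "inv\<^bsub>F2\<^esub> (reduce w) = reduce (inv_word w)"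
    by (intro inv_equality) (auto simp: F2_def reduced_reduce)
  then show ?thesis
    using inv [OF reduced_reduce] by simp
qed

lemma reduce_subst_letters_cong:
  assumes "\<And>i. reduce (g i) = reduce (h i)"
  shows "reduce (subst_letters g w) = reduce (subst_letters h w)"
proof (induction w)
  case (Cons x w)
  let ?g = "\<lambda>g. if snd x then g (fst x) else inv_word (g (fst x))"
  have "reduce (?g g) = reduce (?g h)"
    by (simp add: reduce_inv_word assms)
  with Cons have "reduce (reduce (?g g) @ reduce (subst_letters g w))
      = reduce (reduce (?g h) @ reduce (subst_letters h w))" by simp
  then have "reduce (?g g @ subst_letters g w) = reduce (?g h @ subst_letters h w)"
    by (simp only: reduce_append_left reduce_append_right)
  then show ?case by (simp add: subst_letters_def)
qed simp

lemma endo_endo: "endo u v (endo u' v' w) = endo (endo u v u') (endo u v v') w"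
proof -
  have "endo u v (endo u' v' w) =
      reduce (subst_letters (\<lambda>i. subst_letters (\<lambda>i. if i = 1 then u else v)
        (if i = 1 then u' else v')) w)"
    by (subst (2) endo_def) (simp add: endo_def [of u v] subst_letters_subst_letters)
  also have "\<dots> = endo (endo u v u') (endo u v v') w"
    unfolding endo_def [of "endo u v u'"]
    by (rule reduce_subst_letters_cong) (simp add: endo_def reduce_reduced reduced_reduce)
  finally show ?thesis .
qed

lemma reduce_Cons: "reduce (x # w) = cancel_cons x (reduce w)"
  and reduce_Nil: "reduce [] = []"
  by (simp_all add: reduce_def)

lemma reduce_replicate: "reduce (replicate n x) = replicate n x"
proof (induction n)
  case (Suc n)
  then show ?case by (cases n) (auto simp: reduce_Cons cancel_cons_def)
qed (simp add: reduce_Nil)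

lemma reduced_replicate: "reduced (replicate n x)"
  using reduced_reduce [of "replicate n x"] by (simp add: reduce_replicate)

lemma cancel_cons_letter: "reduced w \<Longrightarrow> cancel_cons (i, True) (cancel_cons (i, False) w) = w"
  using cancel_cons_inverse [of w "(i, True)"] by (simp add: inv_letter_def)

lemma inv_word_replicate: "inv_word (replicate n x) = replicate n (inv_letter x)"
  by (simp add: inv_word_def)

lemma subst_letters_replicate:
  "subst_letters g (replicate n x) = concat (replicate n (if snd x then g (fst x) else inv_word (g (fst x))))"
  by (induction n) auto

lemma concat_replicate_single: "concat (replicate n [x]) = replicate n x"
  by (induction n) auto

lemma endo_id: "endo (gen 1) (gen 2) w = reduce w"
proof -
  have "subst_letters (\<lambda>i. if i = 1 then gen 1 else gen 2) w = w"
  proof (induction w)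
    case (Cons x w)
    then show ?case
      using exhaust_2 [of "fst x"] by (cases x) (auto simp: inv_letter_def)
  qed simp
  then show ?thesis by (simp add: endo_def)
qed

lemmas word_simps = endo_def reduce_append reduce_Cons reduce_Nil cancel_cons_def inv_letter_def
  subst_letters_replicate concat_replicate_single reduce_replicate inv_word_replicate gen_pow_def

lemma iso_endoI:
  assumes "endo u v u' = gen 1" "endo u v v' = gen 2" "endo u' v' u = gen 1" "endo u' v' v = gen 2"
  shows "endo u v \<in> iso F2 F2"
proof -
  have "endo u v (endo u' v' w) = w" "endo u' v' (endo u v w) = w" if "w \<in> carrier F2" for w
    using that assms by (simp_all add: endo_endo endo_id reduce_reduced F2_def)
  moreover have "endo p q w \<in> carrier F2" for p q w
    by (simp add: endo_def F2_def reduced_reduce)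
  ultimately show ?thesis
    using endo_hom by (auto simp: iso_def intro!: bij_betwI [where g = "endo u' v'"])
qed

lemma delta_iso: "delta1 \<in> iso F2 F2" "delta2 \<in> iso F2 F2" "delta4 \<in> iso F2 F2"
proof -
  show "delta1 \<in> iso F2 F2" unfolding delta1_def
    by (rule iso_endoI [where u' = "gen_inv 1 @ gen 2" and v' = "gen 2"]; simp add: word_simps)
  show "delta2 \<in> iso F2 F2" unfolding delta2_def
    by (rule iso_endoI [where u' = "gen 2 @ gen 1" and v' = "gen 2"]; simp add: word_simps)
  show "delta4 \<in> iso F2 F2" unfolding delta4_def
    by (rule iso_endoI [where u' = "gen_inv 1" and v' = "gen 2"]; simp add: word_simps)
qed

lemma sigma1_conjugate:
  assumes "a \<ge> 3"
  shows "delta1 (sigma1 a w) = tau1 a (delta1 w)"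
proof -
  obtain m where a: "a = int m + 3"
    using assms by (metis zle_iff_zadd add.commute)
  let ?u = "replicate m (2, True) @ gen 1 @ gen 2"
  have pow: "gen_pow 2 (a - 3) = replicate m (2, True)"
    "gen_pow 2 (a - 2) = (2, True) # replicate m (2, True)"
    by (simp_all add: a gen_pow_def nat_add_distrib)
  have "endo ?u ((2, True) # ?u) (gen 2 @ gen_inv 1) = cancel_cons (2, True) (reduce (?u @ inv_word ?u))"
    by (simp add: endo_def reduce_Cons)
  also have "\<dots> = gen 2"
    using foldr_inv_word' [of "[]" ?u]
    by (simp only: reduce_def foldr_append reduced_Nil) (simp add: cancel_cons_def)
  finally show ?thesis
    unfolding delta1_def sigma1_def tau1_def endo_endo pow
    by (intro arg_cong2 [where f = "\<lambda>u v. endo u v w"]) (simp_all add: word_simps)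
qed

lemma sigma2_conjugate:
  assumes "a \<le> -3"
  shows "delta2 (sigma2 a w) = tau2 a (delta2 w)"
proof -
  obtain m where "-3 = a + int m"
    using assms by (metis zle_iff_zadd)
  then have a: "a = - int m - 3" by simp
  let ?u = "gen_inv 1 @ (2, False) # replicate m (2, False)"
  have pow: "gen_pow 2 a = (2, False) # (2, False) # (2, False) # replicate m (2, False)"
    "gen_pow 2 (a + 1) = (2, False) # (2, False) # replicate m (2, False)"
    "gen_pow 2 (a + 2) = (2, False) # replicate m (2, False)"
    by (simp_all add: a gen_pow_def nat_add_distrib numeral_eq_Suc)
  have v: "gen_inv 1 @ (2, False) # (2, False) # replicate m (2, False) = ?u @ gen_inv 2"
    by (simp add: replicate_append_same)
  have "endo ?u (?u @ gen_inv 2) (gen_inv 2 @ gen 1) = cancel_cons (2, True) (reduce (inv_word ?u @ ?u))"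
    by (simp add: endo_def reduce_Cons inv_letter_def)
  also have "\<dots> = gen 2"
    using foldr_inv_word [of "[]" ?u]
    by (simp only: reduce_def foldr_append reduced_Nil) (simp add: cancel_cons_def)
  finally have "endo ?u (gen_inv 1 @ (2, False) # (2, False) # replicate m (2, False))
      (gen_inv 2 @ gen 1) = gen 2"
    by (simp only: v)
  moreover have "endo (gen_inv 2 @ gen 1) (gen 2) (gen 2) = gen 2"
    by (simp add: word_simps)
  moreover have "reduced (gen_inv 1 @ gen_pow 2 (a + 1))"
    using reduced_replicate [of "Suc m" "(2, False)"] by (simp add: pow inv_letter_def)
  moreover have "endo (gen_inv 2 @ gen 1) (gen 2) (gen_inv 1 @ gen_pow 2 a)
      = reduce (gen_inv 1 @ gen_pow 2 (a + 1))"
    by (simp add: pow endo_def subst_letters_replicate concat_replicate_single inv_letter_def)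
       (simp add: reduce_Cons [of "(1, False)"] reduce_Cons [of "(2, True)"]
         reduce_Cons [of "(2, False)" "_ # _ # _"] cancel_cons_letter reduced_reduce reduced_cancel_cons)
  ultimately show ?thesis
    unfolding delta2_def sigma2_def tau2_def endo_endo
    by (simp add: reduce_reduced endo_gen pow)
qed

lemma sigma4_conjugate: "delta4 (sigma4 a w) = tau4 a (delta4 w)"
proof -
  have "endo u (gen 2) (gen_pow 2 a) = gen_pow 2 a" for u
    by (cases "0 \<le> a") (simp_all add: word_simps)
  moreover have "endo u v (gen 1 @ w) = reduce (u @ endo u v w)" for u v w
    by (simp add: endo_def)
  moreover have "endo (gen_inv 2) v (gen_inv 1) = gen 2" "endo u v (gen 2) = reduce v" for u v
    by (simp_all add: word_simps)
  ultimately have "endo (gen_inv 1) (gen 2) (gen 1 @ gen_pow 2 a)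
      = endo (gen_inv 2) (gen_inv 1 @ gen_pow 2 a) (gen 2)"
    "endo (gen_inv 1) (gen 2) (gen 2) = endo (gen_inv 2) (gen_inv 1 @ gen_pow 2 a) (gen_inv 1)"
    by (simp_all add: reduce_reduced)
  then show ?thesis
    unfolding delta4_def sigma4_def tau4_def endo_endo by simp
qed

lemma eigenvalue_companion:
  assumes "A $ 1 $ 1 = 0" "A $ 2 $ 1 = 1" "A $ 1 $ 2 = d" "A $ 2 $ 2 = a"
  shows "eigenvalue A l \<longleftrightarrow> l\<^sup>2 = of_int a * l + of_int d"
proof
  assume "eigenvalue A l"
  then obtain v :: "real ^ 2" where v: "v \<noteq> 0" "of_int d * v $ 2 = l * v $ 1"
    "v $ 1 + of_int a * v $ 2 = l * v $ 2"
    using assms by (auto simp: eigenvalue_def vec_eq_iff forall_2 matrix_vector_mult_def sum_2)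
  then have v1: "v $ 1 = (l - of_int a) * v $ 2" by (simp add: algebra_simps)
  then have "v $ 2 \<noteq> 0"
    using v(1) by (auto simp: vec_eq_iff forall_2)
  moreover have "of_int d * v $ 2 = (l * (l - of_int a)) * v $ 2"
    using v(2) v1 by simp
  ultimately have "of_int d = l * (l - of_int a)"
    using mult_right_cancel by blast
  then show "l\<^sup>2 = of_int a * l + of_int d"
    by (simp add: power2_eq_square algebra_simps)
next
  assume "l\<^sup>2 = of_int a * l + of_int d"
  then show "eigenvalue A l"
    using assms unfolding eigenvalue_def
    by (intro exI [of _ "vector [l - of_int a, 1]"])
       (auto simp: vec_eq_iff forall_2 matrix_vector_mult_def sum_2 power2_eq_square algebra_simps)
qed

lemma ex1_expanding_eigenvalue:
  fixes a d :: int
  assumes A: "A $ 1 $ 1 = 0" "A $ 2 $ 1 = 1" "A $ 1 $ 2 = d" "A $ 2 $ 2 = a"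
    and ad: "d = -1 \<and> \<bar>a\<bar> \<ge> 3 \<or> d = 1 \<and> \<bar>a\<bar> \<ge> 1"
  shows "\<exists>!l. eigenvalue A l \<and> \<bar>l\<bar> > 1"
proof (rule ex_ex1I)
  define D where "D = (of_int (a\<^sup>2 + 4 * d) :: real)"
  have "\<bar>a\<bar> * \<bar>a\<bar> \<ge> 3 * 3" if "\<bar>a\<bar> \<ge> 3" using that by (intro mult_mono) auto
  moreover have "\<bar>a\<bar> * \<bar>a\<bar> \<ge> 1 * 1" if "\<bar>a\<bar> \<ge> 1" using that by (intro mult_mono) auto
  ultimately have "a\<^sup>2 + 4 * d \<ge> 5"
    using ad by (auto simp: power2_eq_square)
  then have D: "D \<ge> 2\<^sup>2" "D \<ge> 0"
    unfolding D_def using of_int_le_iff [of 5 "a\<^sup>2 + 4 * d", where 'a = real] by simp_all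
  then have s: "sqrt D \<ge> 2" "(sqrt D)\<^sup>2 = D"
    using real_le_rsqrt by auto
  define l where "l = (of_int a + (if a > 0 then sqrt D else - sqrt D)) / 2"
  have "l\<^sup>2 = of_int a * l + of_int d"
    using s(2) by (auto simp: l_def D_def power2_eq_square field_simps)
  moreover have "\<bar>l\<bar> > 1"
  proof -
    have "a \<ge> 1 \<or> a \<le> -1" using ad by auto
    then have "of_int a \<ge> (1::real) \<and> a > 0 \<or> of_int a \<le> (-1::real) \<and> \<not> a > 0" by linarith
    then show ?thesis using s(1) by (auto simp: l_def)
  qed
  ultimately show "\<exists>l. eigenvalue A l \<and> \<bar>l\<bar> > 1"
    using eigenvalue_companion [OF A] by blast
next
  fix l l' assume "eigenvalue A l \<and> \<bar>l\<bar> > 1" "eigenvalue A l' \<and> \<bar>l'\<bar> > 1"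
  then have l: "l\<^sup>2 = of_int a * l + of_int d" "\<bar>l\<bar> > 1"
    and l': "l'\<^sup>2 = of_int a * l' + of_int d" "\<bar>l'\<bar> > 1"
    using eigenvalue_companion [OF A] by auto
  show "l = l'"
  proof (rule ccontr)
    assume "l \<noteq> l'"
    moreover have "(l - l') * (l + l' - of_int a) = 0"
      using l(1) l'(1) by (simp add: power2_eq_square algebra_simps)
    ultimately have "of_int a = l + l'" by simp
    with l(1) have "of_int d = - (l * l')" by (simp add: power2_eq_square algebra_simps)
    with ad have "\<bar>l\<bar> * \<bar>l'\<bar> = 1" by (auto simp flip: abs_mult)
    moreover have "\<bar>l\<bar> * \<bar>l'\<bar> > 1 * 1" using l(2) l'(2) by (intro mult_strict_mono) auto
    ultimately show False by simp
  qed
qed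

lemma abelianize_gen_pow: "abelianize (gen_pow i k) = axis i k"
proof -
  have "abelianize (replicate n (i, b)) = axis i (if b then int n else - int n)" for n b
    by (induction n) (auto simp: abelianize_def vec_eq_iff axis_def)
  then show ?thesis by (auto simp: gen_pow_def)
qed

lemma abelianize_append: "abelianize (u @ v) = abelianize u + abelianize v"
  by (simp add: abelianize_def)

lemma abelianize_reduce: "abelianize (reduce w) = abelianize w"
proof (induction w)
  case (Cons x w)
  have "abelianize (cancel_cons x u) = abelianize [x] + abelianize u" for u
    by (auto simp: cancel_cons_def abelianize_def inv_letter_def split: list.split)
  with Cons show ?case
    using abelianize_append [of "[x]" w] by (simp add: reduce_Cons)
qed (simp add: reduce_Nil)

lemma incidence_matrix_endo:
  "incidence_matrix (endo u v) $ i $ 1 = abelianize u $ i"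
  "incidence_matrix (endo u v) $ i $ 2 = abelianize v $ i"
  by (simp_all add: incidence_matrix_def endo_def abelianize_reduce)

lemma ex1_expanding_eigenvalue_sigma:
  "a \<ge> 3 \<Longrightarrow> \<exists>!l. eigenvalue (incidence_matrix (sigma1 a)) l \<and> \<bar>l\<bar> > 1"
  "a \<le> -3 \<Longrightarrow> \<exists>!l. eigenvalue (incidence_matrix (sigma2 a)) l \<and> \<bar>l\<bar> > 1"
  "a \<le> -1 \<Longrightarrow> \<exists>!l. eigenvalue (incidence_matrix (sigma4 a)) l \<and> \<bar>l\<bar> > 1"
proof -
  have gens: "abelianize (gen i) = axis i 1" "abelianize ((i, False) # w) = - axis i 1 + abelianize w"
    "abelianize ((i, True) # w) = axis i 1 + abelianize w" "abelianize [] = 0" for i w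
    by (simp_all add: abelianize_def)
  note simps = incidence_matrix_endo abelianize_append abelianize_gen_pow gens axis_def
  show "\<exists>!l. eigenvalue (incidence_matrix (sigma1 a)) l \<and> \<bar>l\<bar> > 1" if "a \<ge> 3"
    using that unfolding sigma1_def
    by (intro ex1_expanding_eigenvalue [where a = a and d = "-1"]) (simp_all add: simps)
  show "\<exists>!l. eigenvalue (incidence_matrix (sigma2 a)) l \<and> \<bar>l\<bar> > 1" if "a \<le> -3"
    using that unfolding sigma2_def
    by (intro ex1_expanding_eigenvalue [where a = a and d = "-1"]) (simp_all add: simps)
  show "\<exists>!l. eigenvalue (incidence_matrix (sigma4 a)) l \<and> \<bar>l\<bar> > 1" if "a \<le> -1"
    using that unfolding sigma4_def
    by (intro ex1_expanding_eigenvalue [where a = a and d = 1]) (simp_all add: simps)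
qed

end

theory Submission
  imports Defs
begin

text \<open>Let \<open>m = \<bar>\<lambda>\<bar>\<close> and measure a lattice point by its inner product \<open>t\<close> with the eigenvector. The faces
  of the discrete line orthogonal to that vector are the edges of a staircase path whose vertices
  satisfy bounds on \<open>t\<close>. The dual substitution maps the edge at \<open>p\<close> to a stretch of staircase near
  \<open>A\<inverse> p\<close>, and \<open>A\<inverse>\<close> divides \<open>t\<close> by \<open>\<lambda>\<close>; since \<open>\<lambda>\<close> solves the characteristic equation, the
  bounds are reproduced exactly. In the first two families a vertical edge has a negative image,
  cancelling one edge in the image of its horizontal neighbour, so both are treated together as a
  corner. For negative \<open>\<lambda>\<close> each application reverses the order on the values \<open>t\<close> and changes the sign
  of the chain, whence the even powers. Consecutive images fit together, so all iterates are
  staircase paths: connected, and without repeated faces because the path is monotone.\<close>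

section \<open>Paths whose steps carry chains\<close>

inductive step_path :: "('p \<Rightarrow> 'g \<Rightarrow> 'p \<Rightarrow> bool) \<Rightarrow> 'p \<Rightarrow> 'g :: comm_monoid_add \<Rightarrow> 'p \<Rightarrow> bool" for R where
  Nil: "step_path R p 0 p"
| Cons: "R p g q \<Longrightarrow> step_path R q h r \<Longrightarrow> step_path R p (g + h) r"

lemma step_path_single: "R p g q \<Longrightarrow> step_path R p g q"
  using step_path.Cons [of R p g q 0 q] step_path.Nil [of R q] by simp

lemma step_path_append: "step_path R p g q \<Longrightarrow> step_path R q h r \<Longrightarrow> step_path R p (g + h) r"
  by (induction rule: step_path.induct) (auto intro: step_path.Cons simp: add.assoc)

lemma step_path_run:
  assumes "\<And>k. k < n \<Longrightarrow> R (p k) (g k) (p (Suc k))"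
  shows "step_path R (p 0) (\<Sum>k<n. g k) (p n)"
  using assms
  by (induction n) (auto intro: step_path.Nil step_path_append step_path_single)

text \<open>Consecutive image paths meet because their ends depend only on the common vertex,
  through \<open>\<phi>\<close>; additivity of \<open>F\<close> then adds up their chains. The dual
  substitution will be such an \<open>F\<close>.\<close>

lemma step_path_map:
  assumes "step_path R p g q" "F 0 = 0" "\<And>g h. F (g + h) = F g + F h"
    and "\<And>p g q. R p g q \<Longrightarrow> step_path R' (\<phi> p) (F g) (\<phi> q)"
  shows "step_path R' (\<phi> p) (F g) (\<phi> q)"
  using assms(1) by induction (auto simp: assms(2,3) intro: step_path.Nil step_path_append assms(4))

text \<open>The variant for direction-reversing maps: images are joined in the opposite order, which
  is harmless because addition of chains commutes.\<close>

lemma step_path_map_rev: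
  assumes "step_path R p g q" "F 0 = 0" "\<And>g h. F (g + h) = F g + F h"
    and "\<And>p g q. R p g q \<Longrightarrow> step_path R' (\<phi> q) (F g) (\<phi> p)"
  shows "step_path R' (\<phi> q) (F g) (\<phi> p)"
  using assms(1)
proof induction
  case (Cons p g q h r)
  then have "step_path R' (\<phi> r) (F h + F g) (\<phi> p)"
    by (blast intro: step_path_append assms(4))
  then show ?case by (simp add: assms(3) add.commute)
qed (simp add: assms(2) step_path.Nil)

section \<open>Simple and connected chains from monotone paths\<close>

lemma connected_segment: "connected (segment f)"
proof -
  have "connected ((\<lambda>s. of_int_vec x + s *\<^sub>R (axis (if i = 1 then 2 else 1) 1 :: real ^ 2)) ` {0..1})" for x and i :: 2
    by (intro connected_continuous_image continuous_intros) simp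
  moreover have "segment (x, i) = (\<lambda>s. of_int_vec x + s *\<^sub>R axis (if i = 1 then 2 else 1) 1) ` {0..1}" for x and i :: 2
    by (auto simp: segment_def)
  ultimately show ?thesis by (cases f) simp
qed

lemma keys_signed_sum:
  assumes "finite B" "\<And>b. b \<in> B \<Longrightarrow> n b \<noteq> 0"
  shows "Poly_Mapping.keys (\<Sum>b\<in>B. frag_cmul (n b) (frag_of b)) = B"
proof -
  have "Poly_Mapping.lookup (\<Sum>b\<in>B. frag_cmul (n b) (frag_of b)) c = (if c \<in> B then n c else 0)" for c
    using assms(1) by (induction B) (auto simp: lookup_add)
  then show ?thesis using assms(2) by (auto simp: in_keys_iff split: if_splits)
qed

text \<open>The strictly increasing height excludes repeated faces.\<close>

lemma simple_connected_chain_path: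
  fixes height :: "int ^ 2 \<Rightarrow> int" and face_height :: "face \<Rightarrow> int"
  assumes step: "\<And>p g q. R p g q \<Longrightarrow> \<exists>f c. c \<in> {- 1, 1} \<and> f \<in> S \<and> g = frag_cmul c (frag_of f)
      \<and> of_int_vec p \<in> segment f \<and> of_int_vec q \<in> segment f
      \<and> face_height f = height p \<and> height p < height q"
    and path: "step_path R p g q"
  shows "g \<in> simple_chains S" "connected_chain g"
proof -
  \<comment> \<open>The invariant exceeds the goal. The lower bound on heights keeps a prepended
    face out of \<open>B\<close>, as its height is that of the earlier vertex; the start vertex in
    the union is the common point that keeps the union connected.\<close>
  have "\<exists>B n. finite B \<and> B \<subseteq> S \<and> (\<forall>b\<in>B. n b \<in> {- 1, 1})
      \<and> g = (\<Sum>b\<in>B. frag_cmul (n b) (frag_of b)) \<and> (\<forall>b\<in>B. height p \<le> face_height b)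
      \<and> connected (\<Union>b\<in>B. segment b) \<and> (B \<noteq> {} \<longrightarrow> of_int_vec p \<in> (\<Union>b\<in>B. segment b))"
    using path
  proof induction
    case (Nil p)
    show ?case by (rule exI [of _ "{}"]) auto
  next
    case (Cons p g q h r)
    obtain f c where f: "c \<in> {- 1, 1}" "f \<in> S" "g = frag_cmul c (frag_of f)"
      "of_int_vec p \<in> segment f" "of_int_vec q \<in> segment f"
      "face_height f = height p" "height p < height q"
      using step [OF Cons.hyps(1)] by blast
    obtain B n where B: "finite B" "B \<subseteq> S" "\<forall>b\<in>B. n b \<in> {- 1, 1}"
      "h = (\<Sum>b\<in>B. frag_cmul (n b) (frag_of b))" "\<forall>b\<in>B. height q \<le> face_height b"
      "connected (\<Union>b\<in>B. segment b)" "B \<noteq> {} \<longrightarrow> of_int_vec q \<in> (\<Union>b\<in>B. segment b)"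
      using Cons.IH by blast
    have fB: "f \<notin> B" using B(5) f(6,7) by force
    have "(\<Sum>b\<in>B. frag_cmul ((n(f := c)) b) (frag_of b)) = h"
      unfolding B(4) using fB by (intro sum.cong) auto
    then have "g + h = (\<Sum>b\<in>insert f B. frag_cmul ((n(f := c)) b) (frag_of b))"
      using B(1) fB f(3) by simp
    moreover have "connected (segment f \<union> (\<Union>b\<in>B. segment b))"
    proof (cases "B = {}")
      case False
      then show ?thesis using B f(5) by (intro connected_Un connected_segment) auto
    qed (simp add: connected_segment)
    ultimately show ?case using f B
      by (intro exI [of _ "insert f B"] exI [of _ "n(f := c)"]) force
  qed
  then obtain B n where B: "finite B" "B \<subseteq> S" "\<forall>b\<in>B. n b \<in> {- 1, 1}"
    "g = (\<Sum>b\<in>B. frag_cmul (n b) (frag_of b))" "connected (\<Union>b\<in>B. segment b)" by blast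
  moreover have "Poly_Mapping.keys g = B"
    unfolding B(4) using B(1,3) by (intro keys_signed_sum) force+
  ultimately show "g \<in> simple_chains S" "connected_chain g"
    by (auto simp: simple_chains_def connected_chain_def)
qed

text \<open>The preimage under \<open>translate_chain y\<close> is obtained by moving every face
  back by \<open>y\<close> and letting it keep its coefficient.\<close>

lemma simple_chains_translate:
  assumes "g \<in> simple_chains S" "\<And>x i. (x, i) \<in> S \<Longrightarrow> (x - y, i) \<in> T"
  shows "g \<in> translate_chain y ` simple_chains T"
proof -
  obtain B n where B: "finite B" "B \<subseteq> S" "\<forall>b\<in>B. n b \<in> {- 1, 1}"
    "g = (\<Sum>b\<in>B. frag_cmul (n b) (frag_of b))"
    using assms(1) by (auto simp: simple_chains_def)
  define \<tau> :: "face \<Rightarrow> face" where "\<tau> = (\<lambda>(x, i). (x - y, i))"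
  define \<tau>' :: "face \<Rightarrow> face" where "\<tau>' = (\<lambda>(x, i). (x + y, i))"
  have inv: "\<tau>' (\<tau> b) = b" for b by (auto simp: \<tau>_def \<tau>'_def split: prod.splits)
  then have inj: "inj_on \<tau> B" by (metis inj_onI)
  define h where "h = (\<Sum>b\<in>\<tau> ` B. frag_cmul ((n \<circ> \<tau>') b) (frag_of b))"
  have "translate_chain y h = (\<Sum>b\<in>\<tau> ` B. frag_cmul ((n \<circ> \<tau>') b) (frag_of (\<tau>' b)))"
    unfolding h_def translate_chain_def \<tau>'_def using B(1)
    by (subst frag_extend_sum) (auto simp: frag_extend_cmul case_prod_unfold intro!: sum.cong)
  also have "\<dots> = g"
    unfolding B(4) by (subst sum.reindex [OF inj]) (simp add: inv)
  finally have "g = translate_chain y h" by simp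
  moreover have "h \<in> simple_chains T"
    unfolding simple_chains_def h_def using B assms(2)
    by (intro CollectI exI [of _ "\<tau> ` B"] exI [of _ "n \<circ> \<tau>'"])
       (auto simp: inv, auto simp: \<tau>_def split: prod.splits)
  ultimately show ?thesis by blast
qed

section \<open>Lattice coordinates and inverse matrices\<close>

definition pt :: "int \<Rightarrow> int \<Rightarrow> int ^ 2" where
  "pt x y = vector [x, y]"

lemma pt_nth [simp]: "pt x y $ 1 = x" "pt x y $ 2 = y"
  by (simp_all add: pt_def)

lemma pt_eqI: "u $ 1 = x \<Longrightarrow> u $ 2 = y \<Longrightarrow> u = pt x y"
  by (simp add: vec_eq_iff forall_2)

lemma pt_simps [simp]:
  "pt x y + pt x' y' = pt (x + x') (y + y')"
  "pt x y - pt x' y' = pt (x - x') (y - y')"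
  "- pt x y = pt (- x) (- y)"
  by (simp_all add: vec_eq_iff forall_2)

lemma axis_pt: "axis 1 c = pt c 0" "axis 2 c = pt 0 c"
  by (simp_all add: vec_eq_iff forall_2 axis_def)

lemma zero_pt: "0 = pt 0 0"
  by (simp add: vec_eq_iff forall_2)

lemma pt_eq_iff [simp]: "pt x y = pt x' y' \<longleftrightarrow> x = x' \<and> y = y'"
  by (auto simp: vec_eq_iff forall_2)

lemma pt_cases: obtains x y where "u = pt x y"
  using pt_eqI by metis

lemma matrix_inv_eqI:
  assumes "A ** B = mat 1" "B ** A = mat 1"
  shows "matrix_inv (A :: 'a::semiring_1 ^ 'n ^ 'n) = B"
proof -
  have "A ** matrix_inv A = mat 1 \<and> matrix_inv A ** A = mat 1"
    unfolding matrix_inv_def by (rule someI [of _ B]) (use assms in blast)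
  then show ?thesis
    by (metis assms(2) matrix_mul_assoc matrix_mul_lid matrix_mul_rid)
qed

text \<open>The adjugate formula; as \<open>d * d = 1\<close>, dividing by the determinant is
  multiplying by it, which stays in the integers.\<close>

lemma matrix_inv_mult_pt:
  fixes A :: "int ^ 2 ^ 2"
  assumes A: "A $ 1 $ 1 = p" "A $ 1 $ 2 = q" "A $ 2 $ 1 = r" "A $ 2 $ 2 = s"
    and d: "p * s - q * r = d" "d * d = 1"
  shows "matrix_inv A *v pt x y = pt (d * (s * x - q * y)) (d * (p * y - r * x))"
proof -
  define B :: "int ^ 2 ^ 2" where "B = vector [vector [d * s, - d * q], vector [- d * r, d * p]]"
  have B: "B $ 1 $ 1 = d * s" "B $ 1 $ 2 = - d * q" "B $ 2 $ 1 = - d * r" "B $ 2 $ 2 = d * p"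
    by (simp_all add: B_def)
  have det: "p * (- d * q) + q * (d * p) = 0" "r * (d * s) + s * (- d * r) = 0"
    "d * s * q + - d * q * s = 0" "- d * r * p + d * p * r = 0"
    "p * (d * s) + q * (- d * r) = 1" "r * (- d * q) + s * (d * p) = 1"
    "d * s * p + - d * q * r = 1" "- d * r * q + d * p * s = 1"
    using d by (simp_all flip: d(1) add: algebra_simps)
  have "A ** B = mat 1"
    by (simp add: vec_eq_iff forall_2 matrix_matrix_mult_def sum_2 mat_def A B det del: mult_minus_left mult_minus_right)
  moreover have "B ** A = mat 1"
    by (simp add: vec_eq_iff forall_2 matrix_matrix_mult_def sum_2 mat_def A B det del: mult_minus_left mult_minus_right)
  ultimately have "matrix_inv A = B" by (rule matrix_inv_eqI)
  then show ?thesis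
    by (simp add: vec_eq_iff forall_2 matrix_vector_mult_def sum_2 B algebra_simps)
qed

section \<open>Images of single faces\<close>

definition suffix_sum :: "(word \<Rightarrow> 'g :: comm_monoid_add) \<Rightarrow> letter \<Rightarrow> word \<Rightarrow> 'g" where
  "suffix_sum G l w = (\<Sum>k | k < length w \<and> w ! k = l. G (drop k w))"

lemma suffix_sum_Nil [simp]: "suffix_sum G l [] = 0"
  by (simp add: suffix_sum_def)

lemma suffix_sum_Cons [simp]:
  "suffix_sum G l (x # w) = (if x = l then G (x # w) else 0) + suffix_sum G l w"
proof -
  have *: "suffix_sum G l w = (\<Sum>k<length w. if w ! k = l then G (drop k w) else 0)" for w
    unfolding suffix_sum_def by (simp flip: sum.inter_filter)
  show ?thesis
    unfolding * by (simp add: sum.lessThan_Suc_shift del: sum.lessThan_Suc cong: if_cong)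
qed

lemma suffix_sum_replicate:
  "suffix_sum G l (replicate n x @ w)
    = (if x = l then \<Sum>m<n. G (replicate (Suc m) x @ w) else 0) + suffix_sum G l w"
  by (induction n) (auto simp: ac_simps)

text \<open>The letter at position \<open>k\<close> heads \<open>drop k w\<close>, so a positive
  letter uses the tail of this suffix and an inverse letter all of it. Both sums then follow by
  recursion on the word.\<close>

lemma dual_face_suffix_sum:
  assumes "matrix_inv (incidence_matrix \<sigma>) = B"
  shows "dual_face \<sigma> (x, i) = (\<Sum>j\<in>UNIV.
      suffix_sum (\<lambda>u. frag_of (B *v (x + abelianize (tl u)), j)) (i, True) (\<sigma> (gen j))
    - suffix_sum (\<lambda>u. frag_of (B *v (x + abelianize u), j)) (i, False) (\<sigma> (gen j)))"
  by (simp add: dual_face_def suffix_sum_def Let_def assms drop_Suc tl_drop)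

lemma abelianize_simps [simp]:
  "abelianize [] = pt 0 0"
  "abelianize ((1, b) # w) = pt (if b then 1 else - 1) 0 + abelianize w"
  "abelianize ((2, b) # w) = pt 0 (if b then 1 else - 1) + abelianize w"
  by (simp_all add: abelianize_def axis_pt zero_pt)

lemma abelianize_replicate:
  "abelianize (replicate n (2, b) @ w) = pt 0 (if b then int n else - int n) + abelianize w"
  by (cases "abelianize w" rule: pt_cases) (induction n, auto)

lemma reduced_replicate_append:
  "reduced (y # w) \<Longrightarrow> y \<noteq> inv_letter x \<Longrightarrow> reduced (replicate n x @ y # w)"
proof (induction n)
  case (Suc n)
  then show ?case by (cases n) auto
qed simp

lemma reduced_Cons_replicate: "x \<noteq> inv_letter y \<Longrightarrow> reduced (y # replicate n x)"
  using reduced_replicate [of n x] by (cases n) auto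

text \<open>The letter 1 occurs only inverted, so a vertical face has a negative image. It cancels
  the \<open>k = 0\<close> face in the image of the horizontal face at the same point, whence the
  corners in \<open>step_pos\<close>.\<close>

lemma dual_face_sigma1:
  assumes "a \<ge> 3"
  shows "dual_face (sigma1 a) (pt x y, 1) = - frag_of (pt (a * x + y + 2 - a) (1 - x), 2)" (is ?th1)
    and "dual_face (sigma1 a) (pt x y, 2) = frag_of (pt (a * x + y) (- x), 1)
      + (\<Sum>k<nat (a - 2). frag_of (pt (a * x + y + 2 - a + int k) (1 - x), 2))
      + frag_of (pt (a * x + y) (- x), 2) + frag_of (pt (a * x + y + 1) (- x), 2)" (is ?th2)
proof -
  let ?w = "replicate (nat (a - 2)) (2, True) @ [(1, False), (2, True), (2, True)]"
  have w: "sigma1 a = endo (gen 2) ?w"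
    using assms by (simp add: sigma1_def gen_pow_def)
  have "reduced ?w"
    by (intro reduced_replicate_append) (auto simp: inv_letter_def)
  then have \<sigma>: "sigma1 a (gen 1) = gen 2" "sigma1 a (gen 2) = ?w"
    unfolding w by (simp_all add: endo_gen)
  have B: "matrix_inv (incidence_matrix (sigma1 a)) *v pt u v = pt (a * u + v) (- u)" for u v
    using assms unfolding w
    by (subst matrix_inv_mult_pt [where p = 0 and q = "- 1" and r = 1 and s = a and d = 1])
       (simp_all add: incidence_matrix_endo abelianize_replicate)
  show ?th1
    by (simp add: dual_face_suffix_sum [OF refl] UNIV_2 \<sigma> suffix_sum_replicate abelianize_replicate B
        algebra_simps)
  show ?th2
    by (simp add: dual_face_suffix_sum [OF refl] UNIV_2 \<sigma> suffix_sum_replicate abelianize_replicate B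
        algebra_simps)
qed

text \<open>Longer suffixes of inverse letters give faces further left, whereas paths list
  horizontal edges from left to right.\<close>

lemma sum_frag_reverse:
  "(\<Sum>m<n. frag_of (pt (x - int m) y, i)) = (\<Sum>k<n. frag_of (pt (x - int n + 1 + int k) y, i))"
  by (subst sum.nat_diff_reindex [symmetric], rule sum.cong) (auto simp: of_nat_diff algebra_simps)

text \<open>The vertical face again has a negative image; that of \<open>(pt (x + 1) y, 1)\<close>
  is also the \<open>k = 0\<close> term in the image of \<open>(pt x y, 2)\<close>. The two cancel
  in the difference taken in \<open>step_neg.corner\<close>.\<close>

lemma dual_face_sigma2:
  assumes "a \<le> - 1"
  shows "dual_face (sigma2 a) (pt x y, 1) = - frag_of (pt (a * x + y) (1 - x), 2)" (is ?th1)
    and "dual_face (sigma2 a) (pt x y, 2) = frag_of (pt (a * x + y) (- x), 1)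
      - (\<Sum>k<nat (- a). frag_of (pt (a * x + y + a + int k) (- x), 2))" (is ?th2)
proof -
  let ?w = "(1, False) # replicate (nat (- a)) (2, False)"
  have w: "sigma2 a = endo (gen 2) ?w"
    using assms by (simp add: sigma2_def gen_pow_def)
  have "reduced ?w"
    by (intro reduced_Cons_replicate) (auto simp: inv_letter_def)
  then have \<sigma>: "sigma2 a (gen 1) = gen 2" "sigma2 a (gen 2) = ?w"
    unfolding w by (simp_all add: endo_gen)
  note rep = suffix_sum_replicate [of _ _ _ _ "[]", simplified]
    abelianize_replicate [of _ _ "[]", simplified]
  have B: "matrix_inv (incidence_matrix (sigma2 a)) *v pt u v = pt (a * u + v) (- u)" for u v
    using assms unfolding w
    by (subst matrix_inv_mult_pt [where p = 0 and q = "- 1" and r = 1 and s = a and d = 1])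
       (simp_all add: incidence_matrix_endo rep)
  show ?th1
    using assms
    by (simp add: dual_face_suffix_sum [OF refl] UNIV_2 \<sigma> rep B algebra_simps)
  show ?th2
    using assms sum_frag_reverse [of "a * x + y - 1" "- x" "2 :: 2" "nat (- a)"]
    by (simp add: dual_face_suffix_sum [OF refl] UNIV_2 \<sigma> rep B algebra_simps)
qed

text \<open>Here the letter 1 occurs positively, so edges need not be grouped into corners.\<close>

lemma dual_face_sigma4:
  assumes "a \<le> - 1"
  shows "dual_face (sigma4 a) (pt x y, 1) = frag_of (pt (y - a * x + a) x, 2)" (is ?th1)
    and "dual_face (sigma4 a) (pt x y, 2) = frag_of (pt (y - a * x) x, 1)
      - (\<Sum>k<nat (- a). frag_of (pt (y - a * x + a + int k) x, 2))" (is ?th2)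
proof -
  let ?w = "(1, True) # replicate (nat (- a)) (2, False)"
  have w: "sigma4 a = endo (gen 2) ?w"
    using assms by (simp add: sigma4_def gen_pow_def)
  have "reduced ?w"
    by (intro reduced_Cons_replicate) (auto simp: inv_letter_def)
  then have \<sigma>: "sigma4 a (gen 1) = gen 2" "sigma4 a (gen 2) = ?w"
    unfolding w by (simp_all add: endo_gen)
  note rep = suffix_sum_replicate [of _ _ _ _ "[]", simplified]
    abelianize_replicate [of _ _ "[]", simplified]
  have B: "matrix_inv (incidence_matrix (sigma4 a)) *v pt u v = pt (v - a * u) u" for u v
    using assms unfolding w
    by (subst matrix_inv_mult_pt [where p = 0 and q = 1 and r = 1 and s = a and d = "- 1"])
       (simp_all add: incidence_matrix_endo rep)
  show ?th1
    using assms
    by (simp add: dual_face_suffix_sum [OF refl] UNIV_2 \<sigma> rep B algebra_simps)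
  show ?th2
    using assms sum_frag_reverse [of "y - a * x - 1" x "2 :: 2" "nat (- a)"]
    by (simp add: dual_face_suffix_sum [OF refl] UNIV_2 \<sigma> rep B algebra_simps)
qed

text \<open>For \<open>delta2\<close> two vertical faces cancel. For \<open>delta1\<close> the face
  at the origin has inner product 0 with the eigenvector, so this chain does not yet consist of
  admissible faces.\<close>

lemma dual_subst_delta:
  "dual_subst delta1 unit_chain = - frag_of (pt 0 0, 1) + frag_of (pt 1 0, 1) + frag_of (pt 0 1, 2)" (is ?th1)
  "dual_subst delta2 unit_chain = frag_of (pt 0 1, 2)" (is ?th2)
  "dual_subst delta4 unit_chain = - frag_of (pt 0 0, 1) + frag_of (pt 0 1, 2)" (is ?th4)
proof -
  note delta = delta1_def delta2_def delta4_def
  have \<delta>: "delta1 (gen 1) = gen 2 @ gen_inv 1" "delta1 (gen 2) = gen 2"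
    "delta2 (gen 1) = gen_inv 2 @ gen 1" "delta2 (gen 2) = gen 2"
    "delta4 (gen 1) = gen_inv 1" "delta4 (gen 2) = gen 2"
    by (simp_all add: delta endo_gen inv_letter_def)
  have B: "matrix_inv (incidence_matrix delta1) *v pt u v = pt (- u) (u + v)"
    "matrix_inv (incidence_matrix delta2) *v pt u v = pt u (u + v)"
    "matrix_inv (incidence_matrix delta4) *v pt u v = pt (- u) v" for u v
    unfolding delta
    by (subst matrix_inv_mult_pt [where p = "- 1" and q = 0 and r = 1 and s = 1 and d = "- 1"]
          matrix_inv_mult_pt [where p = 1 and q = 0 and r = "- 1" and s = 1 and d = 1]
          matrix_inv_mult_pt [where p = "- 1" and q = 0 and r = 0 and s = 1 and d = "- 1"];
        simp add: incidence_matrix_endo)+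
  show ?th1 ?th2 ?th4
    by (simp_all add: dual_subst_def unit_chain_def axis_pt frag_extend_add
        dual_face_suffix_sum [OF refl] UNIV_2 \<delta> B)
qed

section \<open>Strips and the edges of the staircase\<close>

definition strip :: "bool \<Rightarrow> real \<Rightarrow> real \<Rightarrow> real set" where
  "strip s l u = (if s then {l<..u} else {l..<u})"

abbreviation signed :: "bool \<Rightarrow> chain \<Rightarrow> chain" where
  "signed s \<equiv> frag_cmul (if s then 1 else - 1)"

lemma strip_shift:
  "t \<in> strip s l u \<Longrightarrow> l' \<le> l + d \<Longrightarrow> u + d \<le> u' \<Longrightarrow> t' = t + d \<Longrightarrow> t' \<in> strip s l' u'"
  by (auto simp: strip_def split: if_splits)

lemma strip_scale:
  assumes "t \<in> strip s l u" "m > 0" "r * m = t" "l' * m = l" "u' * m = u"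
  shows "r \<in> strip s l' u'"
  using assms by (auto simp: strip_def split: if_splits)

text \<open>Division by \<open>- m\<close> exchanges the two ends, hence also which of them is open.
  Quotients are described by their products with \<open>m\<close> to avoid fractions.\<close>

lemma strip_flip:
  assumes "t \<in> strip s l u" "m > 0" "r * m = - t" "u' * m = - l" "l' * m = - u"
  shows "r \<in> strip (\<not> s) l' u'"
proof -
  have "r * m < u' * m \<longleftrightarrow> l < t" "r * m \<le> u' * m \<longleftrightarrow> l \<le> t"
    "l' * m < r * m \<longleftrightarrow> t < u" "l' * m \<le> r * m \<longleftrightarrow> t \<le> u"
    unfolding assms(3-5) by auto
  then show ?thesis using assms(1,2) by (auto simp: strip_def split: if_splits)
qed

text \<open>The \<open>step\<close> relations contain the pieces on which the dual substitution acts without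
  cancellation, the \<open>edge\<close> relations the single faces. The parameter \<open>s\<close> records the parity of the
  iterate: it decides which end of the strips is open and the sign of the chain.\<close>

inductive step_pos :: "real \<Rightarrow> int ^ 2 \<Rightarrow> chain \<Rightarrow> int ^ 2 \<Rightarrow> bool" for m where
  horizontal: "x + m * y \<in> strip True 0 m \<Longrightarrow> step_pos m (pt x y) (frag_of (pt x y, 2)) (pt (x + 1) y)"
| corner: "x + m * y \<in> strip True 0 1 \<Longrightarrow>
    step_pos m (pt x (y + 1)) (frag_of (pt x y, 1) + frag_of (pt x y, 2)) (pt (x + 1) y)"

inductive edge_pos :: "real \<Rightarrow> int ^ 2 \<Rightarrow> chain \<Rightarrow> int ^ 2 \<Rightarrow> bool" for m where
  horizontal: "x + m * y \<in> strip True 0 m \<Longrightarrow> edge_pos m (pt x y) (frag_of (pt x y, 2)) (pt (x + 1) y)"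
| vertical: "x + m * y \<in> strip True 0 1 \<Longrightarrow> edge_pos m (pt x (y + 1)) (frag_of (pt x y, 1)) (pt x y)"

inductive step_neg :: "real \<Rightarrow> bool \<Rightarrow> int ^ 2 \<Rightarrow> chain \<Rightarrow> int ^ 2 \<Rightarrow> bool" for m s where
  horizontal: "m * y - x \<in> strip s 1 m \<Longrightarrow>
    step_neg m s (pt x y) (signed s (frag_of (pt x y, 2))) (pt (x + 1) y)"
| corner: "m * y - x \<in> strip s 0 1 \<Longrightarrow>
    step_neg m s (pt x y) (signed s (frag_of (pt x y, 2) - frag_of (pt (x + 1) y, 1))) (pt (x + 1) (y + 1))"

inductive edge_neg :: "real \<Rightarrow> bool \<Rightarrow> int ^ 2 \<Rightarrow> chain \<Rightarrow> int ^ 2 \<Rightarrow> bool" for m s where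
  horizontal: "m * y - x \<in> strip s 0 m \<Longrightarrow>
    edge_neg m s (pt x y) (signed s (frag_of (pt x y, 2))) (pt (x + 1) y)"
| vertical: "m * y - x \<in> strip s (- 1) 0 \<Longrightarrow>
    edge_neg m s (pt x y) (- signed s (frag_of (pt x y, 1))) (pt x (y + 1))"

lemma step_path_horizontal:
  assumes "\<And>k. k < n \<Longrightarrow> R (pt (x + int k) y) (g k) (pt (x + int k + 1) y)"
    and "h = (\<Sum>k<n. g k)" "p = pt x y" "q = pt (x + int n) y"
  shows "step_path R p h q"
  using step_path_run [of n R "\<lambda>k. pt (x + int k) y" g] assms by (simp add: ac_simps)

text \<open>Refining corners into edges is \<open>step_path_map\<close> with identity maps;
  \<open>m \<ge> 1\<close> puts the horizontal edge of a corner into the full strip.\<close>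

lemma step_path_edge_pos:
  assumes "step_path (step_pos m) p g q" "m \<ge> 1"
  shows "step_path (edge_pos m) p g q"
  using assms(1)
proof (rule step_path_map [where F = id and \<phi> = id, simplified])
  fix p g q assume "step_pos m p g q"
  then show "step_path (edge_pos m) p g q"
  proof cases
    case (corner x y)
    then have "x + m * y \<in> strip True 0 m"
      using assms(2) by (intro strip_shift [OF corner(4), where d = 0]) auto
    then have "edge_pos m (pt x y) (frag_of (pt x y, 2)) (pt (x + 1) y)"
      by (rule edge_pos.horizontal)
    moreover have "edge_pos m (pt x (y + 1)) (frag_of (pt x y, 1)) (pt x y)"
      using corner(4) by (rule edge_pos.vertical)
    ultimately show ?thesis
      unfolding corner by (blast intro: step_path_append step_path_single)
  qed (auto intro: step_path_single edge_pos.intros)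
qed

lemma step_path_edge_neg:
  assumes "step_path (step_neg m s) p g q" "m \<ge> 1"
  shows "step_path (edge_neg m s) p g q"
  using assms(1)
proof (rule step_path_map [where F = id and \<phi> = id, simplified])
  fix p g q assume "step_neg m s p g q"
  then show "step_path (edge_neg m s) p g q"
  proof cases
    case (horizontal y x)
    then have "m * y - x \<in> strip s 0 m"
      by (intro strip_shift [OF horizontal(4), where d = 0]) auto
    then show ?thesis unfolding horizontal by (intro step_path_single edge_neg.horizontal)
  next
    case (corner y x)
    then have "m * y - x \<in> strip s 0 m" "m * y - real_of_int (x + 1) \<in> strip s (- 1) 0"
      using assms(2)
      by (intro strip_shift [OF corner(4), where d = 0] strip_shift [OF corner(4), where d = "- 1"]; simp)+
    then have "edge_neg m s (pt x y) (signed s (frag_of (pt x y, 2))) (pt (x + 1) y)"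
      "edge_neg m s (pt (x + 1) y) (- signed s (frag_of (pt (x + 1) y, 1))) (pt (x + 1) (y + 1))"
      by - (rule edge_neg.intros, assumption)+
    then have "step_path (edge_neg m s) p (signed s (frag_of (pt x y, 2)) + - signed s (frag_of (pt (x + 1) y, 1))) q"
      unfolding corner by (blast intro: step_path_append step_path_single)
    with corner show ?thesis by (cases s) simp_all
  qed
qed

section \<open>The dual substitution on staircase paths\<close>

lemma dual_subst_zero_add:
  "dual_subst \<sigma> 0 = 0" "dual_subst \<sigma> (g + h) = dual_subst \<sigma> g + dual_subst \<sigma> h"
  by (simp_all add: dual_subst_def frag_extend_add)

lemma dual_subst_simps:
  "dual_subst \<sigma> (- g) = - dual_subst \<sigma> g" "dual_subst \<sigma> (g - h) = dual_subst \<sigma> g - dual_subst \<sigma> h"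
  "dual_subst \<sigma> (frag_cmul c g) = frag_cmul c (dual_subst \<sigma> g)" "dual_subst \<sigma> (frag_of f) = dual_face \<sigma> f"
  by (simp_all add: dual_subst_def frag_extend_minus frag_extend_diff frag_extend_cmul)

lemma reciprocal_bounds:
  assumes "r * m = 1" "m > (1 :: real)"
  shows "0 < r" "r < 1"
proof -
  show "0 < r" using assms by (intro zero_less_mult_pos2 [of r m]) auto
  then show "r < 1" using assms mult_strict_left_mono [of 1 m r] by simp
qed

text \<open>The vertex map is the inverse matrix applied to \<open>p + pt (- 1) 2\<close>, the shift
  being the abelianization of the suffix at the inverse letter. This is where the image of a
  horizontal edge at \<open>p\<close> begins.\<close>

lemma step_path_dual_subst_sigma1:
  assumes a: "a \<ge> 3" and m: "m > 2" "m\<^sup>2 = a * m - 1" and path: "step_path (step_pos m) p g q"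
  shows "step_path (step_pos m) (pt (a * p $ 1 + p $ 2 + 2 - a) (1 - p $ 1)) (dual_subst (sigma1 a) g)
      (pt (a * q $ 1 + q $ 2 + 2 - a) (1 - q $ 1))"
  using path
proof (rule step_path_map [OF _ dual_subst_zero_add])
  \<comment> \<open>Thus \<open>a - m\<close> is \<open>1 / m\<close>, the contracting
    eigenvalue.\<close>
  have m1: "(a - m) * m = 1" using m by (simp add: algebra_simps power2_eq_square)
  then have am: "a - m > 0" "a - m < 1"
    using reciprocal_bounds [OF m1] m(1) by auto
  \<comment> \<open>The characteristic equation as a rewrite rule, also in the shape of right-nested
    products.\<close>
  have mm: "m * m = a * m - 1" "m * (m * z) = a * (m * z) - z" for z
    using m(2) by (simp_all add: power2_eq_square left_diff_distrib distrib_right flip: mult.assoc)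
  fix p g q assume "step_pos m p g q"
  then show "step_path (step_pos m) (pt (a * p $ 1 + p $ 2 + 2 - a) (1 - p $ 1)) (dual_subst (sigma1 a) g)
      (pt (a * q $ 1 + q $ 2 + 2 - a) (1 - q $ 1))"
  proof cases
    case (horizontal x y)
    define X where "X = a * x + y"
    \<comment> \<open>The point \<open>pt X (- x)\<close> is the inverse matrix applied to
      \<open>pt x y\<close>, so its inner product is divided by \<open>m\<close>: the strip up to
      \<open>m\<close> becomes the strip up to 1 that a corner demands.\<close>
    have r: "X + m * - x \<in> strip True 0 1"
      using m(1)
      by (intro strip_scale [where m = m, OF horizontal(4)]) (auto simp: X_def mm algebra_simps)
    have "step_path (step_pos m) (pt (X + 2 - a) (1 - x))
        (\<Sum>k<nat (a - 2). frag_of (pt (X + 2 - a + int k) (1 - x), 2)) (pt X (1 - x))"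
    proof (rule step_path_horizontal [OF _ refl refl])
      fix k assume k: "k < nat (a - 2)"
      have "real k \<le> a - 3" using k by linarith
      then have "real_of_int (X + 2 - a + int k) + m * real_of_int (1 - x) \<in> strip True 0 m"
        using am k by (intro strip_shift [OF r, where d = "2 - a + k + m"]) (auto simp: algebra_simps)
      then show "step_pos m (pt (X + 2 - a + int k) (1 - x)) (frag_of (pt (X + 2 - a + int k) (1 - x), 2))
          (pt (X + 2 - a + int k + 1) (1 - x))"
        by (rule step_pos.horizontal)
    qed (use a in simp)
    moreover have "step_pos m (pt X (1 - x)) (frag_of (pt X (- x), 1) + frag_of (pt X (- x), 2)) (pt (X + 1) (- x))"
      using step_pos.corner [of X m "- x"] r by simp
    moreover have "step_pos m (pt (X + 1) (- x)) (frag_of (pt (X + 1) (- x), 2)) (pt (X + 2) (- x))"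
      using step_pos.horizontal [of "X + 1" m "- x"] strip_shift [OF r, of 0 1 m] m by (simp add: algebra_simps)
    ultimately have "step_path (step_pos m) (pt (X + 2 - a) (1 - x))
        ((\<Sum>k<nat (a - 2). frag_of (pt (X + 2 - a + int k) (1 - x), 2))
          + ((frag_of (pt X (- x), 1) + frag_of (pt X (- x), 2)) + frag_of (pt (X + 1) (- x), 2)))
        (pt (X + 2) (- x))"
      by (blast intro: step_path_append step_path_single)
    then show ?thesis
      unfolding horizontal using a
      by (simp add: dual_subst_simps dual_face_sigma1 X_def algebra_simps)
  next
    case (corner x y)
    define X where "X = a * x + y"
    have r: "X + m * - x \<in> strip True 0 (a - m)"
      using m(1)
      by (intro strip_scale [where m = m, OF corner(4)]) (auto simp: X_def mm algebra_simps)
    have r': "X + m * - x \<in> strip True 0 1"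
      using am by (intro strip_shift [OF r, where d = 0]) auto
    have "step_path (step_pos m) (pt (X + 3 - a) (1 - x))
        (\<Sum>k<nat (a - 3). frag_of (pt (X + 3 - a + int k) (1 - x), 2)) (pt X (1 - x))"
    proof (rule step_path_horizontal [OF _ refl refl])
      fix k assume k: "k < nat (a - 3)"
      have "real k \<le> a - 4" using k by linarith
      then have "real_of_int (X + 3 - a + int k) + m * real_of_int (1 - x) \<in> strip True 0 m"
        using am k by (intro strip_shift [OF r, where d = "3 - a + k + m"]) (auto simp: algebra_simps)
      then show "step_pos m (pt (X + 3 - a + int k) (1 - x)) (frag_of (pt (X + 3 - a + int k) (1 - x), 2))
          (pt (X + 3 - a + int k + 1) (1 - x))"
        by (rule step_pos.horizontal)
    qed (use a in simp)
    moreover have "step_pos m (pt X (1 - x)) (frag_of (pt X (- x), 1) + frag_of (pt X (- x), 2)) (pt (X + 1) (- x))"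
      using step_pos.corner [of X m "- x"] r' by simp
    moreover have "step_pos m (pt (X + 1) (- x)) (frag_of (pt (X + 1) (- x), 2)) (pt (X + 2) (- x))"
      using step_pos.horizontal [of "X + 1" m "- x"] strip_shift [OF r', of 0 1 m] m by (simp add: algebra_simps)
    ultimately have "step_path (step_pos m) (pt (X + 3 - a) (1 - x))
        ((\<Sum>k<nat (a - 3). frag_of (pt (X + 3 - a + int k) (1 - x), 2))
          + ((frag_of (pt X (- x), 1) + frag_of (pt X (- x), 2)) + frag_of (pt (X + 1) (- x), 2)))
        (pt (X + 2) (- x))"
      by (blast intro: step_path_append step_path_single)
    \<comment> \<open>The image of the vertical face removes the first face of the run, which exists
      since \<open>a \<ge> 3\<close>. The path therefore starts one vertex later, as the start
      \<open>pt x (y + 1)\<close> of the corner requires.\<close>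
    moreover have "nat (a - 2) = Suc (nat (a - 3))" using a by simp
    then have "(\<Sum>k<nat (a - 2). frag_of (pt (X + 2 - a + int k) (1 - x), 2 :: 2))
      = frag_of (pt (X + 2 - a) (1 - x), 2)
        + (\<Sum>k<nat (a - 3). frag_of (pt (X + 3 - a + int k) (1 - x), 2))"
      by (simp add: sum.lessThan_Suc_shift algebra_simps del: sum.lessThan_Suc)
    ultimately show ?thesis
      unfolding corner using a
      by (simp add: dual_subst_simps dual_subst_zero_add dual_face_sigma1 X_def algebra_simps)
  qed
qed

text \<open>Both eigenvalues are negative: \<open>- m\<close> flips the strips and hence
  \<open>s\<close>, while the other one, governing the direction along the line, reverses the
  path.\<close>

lemma step_path_dual_subst_sigma2:
  assumes a: "a \<le> -3" and m: "m > 1" "m\<^sup>2 = - a * m - 1" and path: "step_path (step_neg m s) p g q"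
  shows "step_path (step_neg m (\<not> s)) (pt (a * q $ 1 + q $ 2) (1 - q $ 1)) (dual_subst (sigma2 a) g)
      (pt (a * p $ 1 + p $ 2) (1 - p $ 1))"
  using path
proof (rule step_path_map_rev [OF _ dual_subst_zero_add])
  have "(- a - m) * m = 1" using m by (simp add: algebra_simps power2_eq_square)
  then have am: "a + m < 0" "a + m > - 1"
    using reciprocal_bounds [of "- a - m" m] m(1) by auto
  have mm: "m * m = - a * m - 1" "m * (m * z) = - a * (m * z) - z" for z
    using m(2) by (simp_all add: power2_eq_square left_diff_distrib distrib_right flip: mult.assoc)
  fix p g q assume "step_neg m s p g q"
  then show "step_path (step_neg m (\<not> s)) (pt (a * q $ 1 + q $ 2) (1 - q $ 1)) (dual_subst (sigma2 a) g)
      (pt (a * p $ 1 + p $ 2) (1 - p $ 1))"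
  proof cases
    case (horizontal y x)
    define X where "X = a * x + y"
    have r: "m * - x - X \<in> strip (\<not> s) (- 1) (a + m)"
      using m(1)
      by (intro strip_flip [where m = m, OF horizontal(4)]) (auto simp: X_def mm algebra_simps)
    have "step_path (step_neg m (\<not> s)) (pt (X + a) (- x))
        (\<Sum>k<nat (- a - 1). signed (\<not> s) (frag_of (pt (X + a + int k) (- x), 2))) (pt (X - 1) (- x))"
    proof (rule step_path_horizontal [OF _ refl refl])
      fix k assume k: "k < nat (- a - 1)"
      have "real k \<le> - a - 2" using k by linarith
      then have "m * real_of_int (- x) - real_of_int (X + a + int k) \<in> strip (\<not> s) 1 m"
        using am by (intro strip_shift [OF r, where d = "- a - k"]) (auto simp: algebra_simps)
      then show "step_neg m (\<not> s) (pt (X + a + int k) (- x)) (signed (\<not> s) (frag_of (pt (X + a + int k) (- x), 2)))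
          (pt (X + a + int k + 1) (- x))"
        by (rule step_neg.horizontal)
    qed (use a in simp)
    moreover have "step_neg m (\<not> s) (pt (X - 1) (- x))
        (signed (\<not> s) (frag_of (pt (X - 1) (- x), 2) - frag_of (pt X (- x), 1))) (pt X (1 - x))"
      using step_neg.corner [of m "- x" "X - 1" "\<not> s"] strip_shift [OF r, of 0 1 1] am by (simp add: algebra_simps)
    ultimately have "step_path (step_neg m (\<not> s)) (pt (X + a) (- x))
        ((\<Sum>k<nat (- a - 1). signed (\<not> s) (frag_of (pt (X + a + int k) (- x), 2)))
          + signed (\<not> s) (frag_of (pt (X - 1) (- x), 2) - frag_of (pt X (- x), 1))) (pt X (1 - x))"
      by (blast intro: step_path_append step_path_single)
    \<comment> \<open>The last face of the run is split off, since it forms the corner with the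
      vertical face.\<close>
    moreover have "nat (- a) = Suc (nat (- a - 1))" using a by simp
    then have "(\<Sum>k<nat (- a). frag_of (pt (X + a + int k) (- x), 2 :: 2))
      = (\<Sum>k<nat (- a - 1). frag_of (pt (X + a + int k) (- x), 2)) + frag_of (pt (X - 1) (- x), 2)"
      using a by simp
    ultimately show ?thesis
      unfolding horizontal using a
      by (cases s) (simp_all add: dual_subst_simps dual_face_sigma2 X_def algebra_simps sum_negf)
  next
    case (corner y x)
    define X where "X = a * x + y"
    have r: "m * - x - X \<in> strip (\<not> s) (a + m) 0"
      using m(1)
      by (intro strip_flip [where m = m, OF corner(4)]) (auto simp: X_def mm algebra_simps)
    have "step_path (step_neg m (\<not> s)) (pt (X + a + 1) (- x))
        (\<Sum>k<nat (- a - 2). signed (\<not> s) (frag_of (pt (X + a + 1 + int k) (- x), 2))) (pt (X - 1) (- x))"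
    proof (rule step_path_horizontal [OF _ refl refl])
      fix k assume k: "k < nat (- a - 2)"
      have "real k \<le> - a - 3" using k by linarith
      then have "m * real_of_int (- x) - real_of_int (X + a + 1 + int k) \<in> strip (\<not> s) 1 m"
        using am by (intro strip_shift [OF r, where d = "- a - 1 - k"]) (auto simp: algebra_simps)
      then show "step_neg m (\<not> s) (pt (X + a + 1 + int k) (- x)) (signed (\<not> s) (frag_of (pt (X + a + 1 + int k) (- x), 2)))
          (pt (X + a + 1 + int k + 1) (- x))"
        by (rule step_neg.horizontal)
    qed (use a in simp)
    moreover have "step_neg m (\<not> s) (pt (X - 1) (- x))
        (signed (\<not> s) (frag_of (pt (X - 1) (- x), 2) - frag_of (pt X (- x), 1))) (pt X (1 - x))"
      using step_neg.corner [of m "- x" "X - 1" "\<not> s"] strip_shift [OF r, of 0 1 1] am by (simp add: algebra_simps)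
    ultimately have "step_path (step_neg m (\<not> s)) (pt (X + a + 1) (- x))
        ((\<Sum>k<nat (- a - 2). signed (\<not> s) (frag_of (pt (X + a + 1 + int k) (- x), 2)))
          + signed (\<not> s) (frag_of (pt (X - 1) (- x), 2) - frag_of (pt X (- x), 1))) (pt X (1 - x))"
      by (blast intro: step_path_append step_path_single)
    \<comment> \<open>The first face of the run, whose start lies beyond the strip, is cancelled by
      the image of the vertical face; the last one again belongs to the corner.\<close>
    moreover have "nat (- a) = Suc (Suc (nat (- a - 2)))" using a by simp
    then have "(\<Sum>k<nat (- a). frag_of (pt (X + a + int k) (- x), 2 :: 2))
      = frag_of (pt (X + a) (- x), 2)
        + ((\<Sum>k<nat (- a - 2). frag_of (pt (X + a + 1 + int k) (- x), 2)) + frag_of (pt (X - 1) (- x), 2))"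
      unfolding \<open>nat (- a) = _\<close> by (subst sum.lessThan_Suc_shift) (use a in \<open>simp add: algebra_simps\<close>)
    ultimately show ?thesis
      unfolding corner using a
      by (cases s) (simp_all add: dual_subst_simps dual_face_sigma2 X_def algebra_simps sum_negf)
  qed
qed

text \<open>The other eigenvalue \<open>a + m\<close> is positive, so the path keeps its direction,
  while \<open>- m\<close> still flips the strips.\<close>

lemma step_path_dual_subst_sigma4:
  assumes a: "a \<le> -1" and m: "m > 1" "m\<^sup>2 = - a * m + 1" and path: "step_path (edge_neg m s) p g q"
  shows "step_path (edge_neg m (\<not> s)) (pt (p $ 2 - a * p $ 1 + a) (p $ 1)) (dual_subst (sigma4 a) g)
      (pt (q $ 2 - a * q $ 1 + a) (q $ 1))"
  using path
proof (rule step_path_map [OF _ dual_subst_zero_add])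
  have m1: "(a + m) * m = 1" using m by (simp add: algebra_simps power2_eq_square)
  then have am: "a + m > 0"
    using reciprocal_bounds [OF m1] m(1) by auto
  have mm: "m * m = - a * m + 1" "m * (m * z) = - a * (m * z) + z" for z
    using m(2) by (simp_all add: power2_eq_square left_diff_distrib distrib_right flip: mult.assoc)
  fix p g q assume "edge_neg m s p g q"
  then show "step_path (edge_neg m (\<not> s)) (pt (p $ 2 - a * p $ 1 + a) (p $ 1)) (dual_subst (sigma4 a) g)
      (pt (q $ 2 - a * q $ 1 + a) (q $ 1))"
  proof cases
    case (horizontal y x)
    define X where "X = y - a * x"
    have r: "m * x - X \<in> strip (\<not> s) (- 1) 0"
      using m(1)
      by (intro strip_flip [where m = m, OF horizontal(4)]) (auto simp: X_def mm algebra_simps)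
    have "step_path (edge_neg m (\<not> s)) (pt (X + a) x)
        (\<Sum>k<nat (- a). signed (\<not> s) (frag_of (pt (X + a + int k) x, 2))) (pt X x)"
    proof (rule step_path_horizontal [OF _ refl refl])
      fix k assume k: "k < nat (- a)"
      have "real k \<le> - a - 1" using k by linarith
      then have "m * real_of_int x - real_of_int (X + a + int k) \<in> strip (\<not> s) 0 m"
        using am by (intro strip_shift [OF r, where d = "- a - k"]) (auto simp: algebra_simps)
      then show "edge_neg m (\<not> s) (pt (X + a + int k) x) (signed (\<not> s) (frag_of (pt (X + a + int k) x, 2)))
          (pt (X + a + int k + 1) x)"
        by (rule edge_neg.horizontal)
    qed (use a in simp)
    moreover have "edge_neg m (\<not> s) (pt X x) (- signed (\<not> s) (frag_of (pt X x, 1))) (pt X (x + 1))"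
      using r by (rule edge_neg.vertical)
    ultimately have "step_path (edge_neg m (\<not> s)) (pt (X + a) x)
        ((\<Sum>k<nat (- a). signed (\<not> s) (frag_of (pt (X + a + int k) x, 2)))
          + - signed (\<not> s) (frag_of (pt X x, 1))) (pt X (x + 1))"
      by (blast intro: step_path_append step_path_single)
    then show ?thesis
      unfolding horizontal using a
      by (cases s) (simp_all add: dual_subst_simps dual_face_sigma4 X_def algebra_simps sum_negf)
  next
    case (vertical y x)
    define X where "X = y - a * x"
    have r: "m * x - X \<in> strip (\<not> s) 0 (a + m)"
      using m(1)
      by (intro strip_flip [where m = m, OF vertical(4)]) (auto simp: X_def mm algebra_simps)
    \<comment> \<open>The shift by \<open>- a\<close> carries the upper bound \<open>a + m\<close>
      exactly to \<open>m\<close>.\<close>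
    have "edge_neg m (\<not> s) (pt (X + a) x) (signed (\<not> s) (frag_of (pt (X + a) x, 2))) (pt (X + a + 1) x)"
      using a by (intro edge_neg.horizontal strip_shift [OF r, where d = "- a"]) auto
    then show ?thesis
      unfolding vertical using a step_path_single
      by (cases s) (fastforce simp: dual_subst_simps dual_face_sigma4 X_def algebra_simps)+
  qed
qed

section \<open>Size of the expanding eigenvalues\<close>

lemma expanding_eigenvalue_sigma1:
  assumes "a \<ge> 3"
  defines "l \<equiv> expanding_eigenvalue (incidence_matrix (sigma1 a))"
  shows "l\<^sup>2 = a * l - 1" "l > 2"
proof -
  let ?A = "incidence_matrix (sigma1 a)"
  have A: "?A $ 1 $ 1 = 0" "?A $ 2 $ 1 = 1" "?A $ 1 $ 2 = - 1" "?A $ 2 $ 2 = a"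
    using assms(1) by (simp_all add: sigma1_def incidence_matrix_endo abelianize_append abelianize_gen_pow axis_pt)
  have "eigenvalue ?A l \<and> \<bar>l\<bar> > 1"
    unfolding l_def expanding_eigenvalue_def by (rule theI' [OF ex1_expanding_eigenvalue_sigma(1) [OF assms(1)]])
  then show l: "l\<^sup>2 = a * l - 1"
    using eigenvalue_companion [OF A] by simp
  have "0 \<le> a * l - 1" using l by (metis zero_le_power2)
  then have "0 < a * l" by simp
  then have "l > 0" using assms(1) by (simp add: zero_less_mult_iff)
  then have "l > 1" using \<open>eigenvalue ?A l \<and> \<bar>l\<bar> > 1\<close> by simp
  \<comment> \<open>Since \<open>a - l\<close> is \<open>1 / l\<close>, it is less than 1, so
    \<open>l\<close> exceeds \<open>a - 1\<close>. The bound 2 leaves room for the horizontal edge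
    that follows a corner.\<close>
  moreover have "(a - l) * l = 1" using l by (simp add: power2_eq_square algebra_simps)
  ultimately show "l > 2" using reciprocal_bounds [of "a - l" l] assms(1) by simp
qed

lemma expanding_eigenvalue_sigma2:
  assumes "a \<le> - 3"
  defines "m \<equiv> - expanding_eigenvalue (incidence_matrix (sigma2 a))"
  shows "m\<^sup>2 = - a * m - 1" "m > 1"
proof -
  let ?A = "incidence_matrix (sigma2 a)"
  have A: "?A $ 1 $ 1 = 0" "?A $ 2 $ 1 = 1" "?A $ 1 $ 2 = - 1" "?A $ 2 $ 2 = a"
    using assms(1) by (simp_all add: sigma2_def incidence_matrix_endo abelianize_append abelianize_gen_pow axis_pt)
  have m: "eigenvalue ?A (- m) \<and> \<bar>- m\<bar> > 1"
    unfolding m_def expanding_eigenvalue_def minus_minus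
    by (rule theI' [OF ex1_expanding_eigenvalue_sigma(2) [OF assms(1)]])
  then show l: "m\<^sup>2 = - a * m - 1"
    using eigenvalue_companion [OF A] by simp
  have "0 \<le> - a * m - 1" using l by (metis zero_le_power2)
  then have "0 < - a * m" by simp
  then have "m > 0" using assms(1) by (simp add: mult_less_0_iff)
  then show "m > 1" using m by simp
qed

lemma expanding_eigenvalue_sigma4:
  assumes "a \<le> - 1"
  defines "m \<equiv> - expanding_eigenvalue (incidence_matrix (sigma4 a))"
  shows "m\<^sup>2 = - a * m + 1" "m > 1"
proof -
  let ?A = "incidence_matrix (sigma4 a)"
  have A: "?A $ 1 $ 1 = 0" "?A $ 2 $ 1 = 1" "?A $ 1 $ 2 = 1" "?A $ 2 $ 2 = a"
    using assms(1) by (simp_all add: sigma4_def incidence_matrix_endo abelianize_append abelianize_gen_pow axis_pt)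
  have m: "eigenvalue ?A (- m) \<and> \<bar>- m\<bar> > 1"
    unfolding m_def expanding_eigenvalue_def minus_minus
    by (rule theI' [OF ex1_expanding_eigenvalue_sigma(3) [OF assms(1)]])
  then show l: "m\<^sup>2 = - a * m + 1"
    using eigenvalue_companion [OF A] by simp
  have "m > 0"
  proof (rule ccontr)
    assume "\<not> m > 0"
    then have "m < - 1" using m by auto
    then have "- a * m + 1 \<le> 0"
      using assms(1) mult_left_mono_neg [of "real_of_int a" "- 1" m] by (simp add: mult.commute)
    moreover have "m\<^sup>2 > 0" using \<open>m < - 1\<close> by simp
    ultimately show False using l by simp
  qed
  then show "m > 1" using m by simp
qed

section \<open>From staircase paths to the chains of the theorem\<close>

lemma inner_of_int_vec_pt: "of_int_vec (pt x y) \<bullet> vector [u, v] = x * u + y * (v :: real)"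
  by (simp add: inner_vec_def sum_2 of_int_vec_def)

lemma mem_segment:
  "of_int_vec (pt x y) \<in> segment (pt x y, i)"
  "of_int_vec (pt (x + 1) y) \<in> segment (pt x y, 2)"
  "of_int_vec (pt x (y + 1)) \<in> segment (pt x y, 1)"
  by (auto simp: segment_def of_int_vec_def vec_eq_iff forall_2 axis_def
      intro: exI [of _ "0 :: real"] exI [of _ "1 :: real"])

text \<open>Edges run right or down, so the first coordinate minus the second increases. A vertical
  face is based at its lower end but entered at the upper one, hence the correction by 1.\<close>

lemma step_pos_path_simple_connected:
  assumes "step_path (step_pos m) p g q" "m \<ge> 1"
  shows "g \<in> simple_chains (faces_pos (vector [1, m]))" "connected_chain g"
proof -
  have "\<exists>f c. c \<in> {- 1, 1} \<and> f \<in> faces_pos (vector [1, m]) \<and> g = frag_cmul c (frag_of f)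
      \<and> of_int_vec p \<in> segment f \<and> of_int_vec q \<in> segment f
      \<and> (case f of (x, i) \<Rightarrow> x $ 1 - x $ 2 - (if i = 1 then 1 else 0)) = p $ 1 - p $ 2
      \<and> p $ 1 - p $ 2 < q $ 1 - q $ 2" if "edge_pos m p g q" for p g q
    using that
  proof cases
    case (horizontal x y)
    then show ?thesis
      by (intro exI [of _ "(pt x y, 2)"] exI [of _ 1])
         (auto simp: mem_segment faces_pos_def inner_of_int_vec_pt axis_pt strip_def right_diff_distrib mult.commute)
  next
    case (vertical x y)
    then show ?thesis
      by (intro exI [of _ "(pt x y, 1)"] exI [of _ 1])
         (auto simp: mem_segment faces_pos_def inner_of_int_vec_pt axis_pt strip_def right_diff_distrib mult.commute)
  qed
  note * = simple_connected_chain_path [OF this step_path_edge_pos [OF assms]]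
  show "g \<in> simple_chains (faces_pos (vector [1, m]))" "connected_chain g"
    by (rule *, assumption)+
qed

lemma mem_faces_neg:
  "(u, 1) \<in> faces_neg v \<longleftrightarrow> of_int_vec u \<bullet> v > 0 \<and> of_int_vec (u + axis 1 1) \<bullet> v \<le> 0"
  "(u, 2) \<in> faces_neg v \<longleftrightarrow>
    of_int_vec (u + axis 1 1) \<bullet> v > 0 \<and> of_int_vec (u + axis 1 1 - axis 2 1) \<bullet> v \<le> 0"
  by (auto simp: faces_neg_def)

text \<open>Edges run right or up and are entered at their base points, so the coordinate sum is a
  height without correction. For \<open>s\<close> true the strips are those of
  \<open>faces_neg\<close> moved by the first unit vector.\<close>

lemma edge_neg_path_simple_connected:
  assumes "step_path (edge_neg m s) p g q"
  shows "connected_chain g"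
    and "s \<Longrightarrow> g \<in> translate_chain (axis 1 1) ` simple_chains (faces_neg (vector [- 1, m]))"
proof -
  define S :: "face set" where
    "S = {(pt x y, 2) | x y. m * y - x \<in> strip s 0 m} \<union> {(pt x y, 1) | x y. m * y - x \<in> strip s (- 1) 0}"
  have "\<exists>f c. c \<in> {- 1, 1} \<and> f \<in> S \<and> g = frag_cmul c (frag_of f)
      \<and> of_int_vec p \<in> segment f \<and> of_int_vec q \<in> segment f
      \<and> fst f $ 1 + fst f $ 2 = p $ 1 + p $ 2
      \<and> p $ 1 + p $ 2 < q $ 1 + q $ 2" if "edge_neg m s p g q" for p g q
    using that
  proof cases
    case (horizontal y x)
    then show ?thesis
      by (intro exI [of _ "(pt x y, 2)"] exI [of _ "if s then 1 else - 1"])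
         (auto simp: mem_segment S_def)
  next
    case (vertical y x)
    then show ?thesis
      by (intro exI [of _ "(pt x y, 1)"] exI [of _ "if s then - 1 else 1"])
         (auto simp: mem_segment S_def)
  qed
  note * = simple_connected_chain_path [OF this assms]
  show "connected_chain g" by (rule *(2), assumption)
  assume s
  have "g \<in> simple_chains S" by (rule *(1), assumption)
  then show "g \<in> translate_chain (axis 1 1) ` simple_chains (faces_neg (vector [- 1, m]))"
  proof (rule simple_chains_translate)
    fix u i assume "(u, i) \<in> S"
    with \<open>s\<close> show "(u - axis 1 1, i) \<in> faces_neg (vector [- 1, m])"
      by (auto simp: S_def mem_faces_neg inner_of_int_vec_pt axis_pt strip_def algebra_simps)
  qed
qed

section \<open>The iterates as staircase paths\<close>

lemma step_path_iterate_sigma1: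
  assumes a: "a \<ge> 3" and m: "m > 2" "m\<^sup>2 = a * m - 1"
  shows "\<exists>p q. step_path (step_pos m) p ((dual_subst (sigma1 a) ^^ Suc n) (dual_subst delta1 unit_chain)) q"
proof (induction n)
  \<comment> \<open>The induction starts at the first iterate, because the initial chain contains
    the inadmissible face at the origin.\<close>
  case 0
  have "(a - m) * m = 1" using m by (simp add: algebra_simps power2_eq_square)
  then have am: "a - m > 0" "a - m < 1"
    using reciprocal_bounds [of "a - m" m] m(1) by auto
  have "step_path (step_pos m) (pt (2 - a) 1) (\<Sum>k<nat (a - 1). frag_of (pt (2 - a + int k) 1, 2)) (pt 1 1)"
  proof (rule step_path_horizontal [OF _ refl refl])
    fix k assume "k < nat (a - 1)"
    then have "real k \<le> a - 2" by linarith
    then have "real_of_int (2 - a + int k) + m * real_of_int 1 \<in> strip True 0 m"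
      using am by (auto simp: strip_def)
    then show "step_pos m (pt (2 - a + int k) 1) (frag_of (pt (2 - a + int k) 1, 2)) (pt (2 - a + int k + 1) 1)"
      by (rule step_pos.horizontal)
  qed (use a in simp)
  moreover have "step_pos m (pt 1 1) (frag_of (pt 1 0, 1) + frag_of (pt 1 0, 2)) (pt 2 0)"
    using step_pos.corner [of 1 m 0] by (simp add: strip_def)
  ultimately have "step_path (step_pos m) (pt (2 - a) 1)
      ((\<Sum>k<nat (a - 1). frag_of (pt (2 - a + int k) 1, 2)) + (frag_of (pt 1 0, 1) + frag_of (pt 1 0, 2))) (pt 2 0)"
    by (blast intro: step_path_append step_path_single)
  moreover have "nat (a - 1) = Suc (nat (a - 2))" using a by simp
  then have "(\<Sum>k<nat (a - 1). frag_of (pt (2 - a + int k) 1, 2 :: 2))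
      = frag_of (pt (2 - a) 1, 2) + (\<Sum>k<nat (a - 2). frag_of (pt (3 - a + int k) 1, 2))"
    by (simp add: sum.lessThan_Suc_shift algebra_simps del: sum.lessThan_Suc)
  \<comment> \<open>The faces \<open>(pt 2 0, 2)\<close> in the images of \<open>(pt 1 0, 1)\<close>
    and \<open>(pt 0 1, 2)\<close> cancel.\<close>
  moreover have "dual_subst (sigma1 a) (dual_subst delta1 unit_chain)
      = frag_of (pt (2 - a) 1, 2) + (\<Sum>k<nat (a - 2). frag_of (pt (3 - a + int k) 1, 2))
        + (frag_of (pt 1 0, 1) + frag_of (pt 1 0, 2))"
    using a by (simp add: dual_subst_delta dual_subst_simps dual_subst_zero_add dual_face_sigma1 algebra_simps
        del: add_uminus_conv_diff)
  ultimately show ?case by auto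
next
  case (Suc n)
  then show ?case using step_path_dual_subst_sigma1 [OF a m] by fastforce
qed

text \<open>The initial chain is already a path: its single edge starts at the closed end
  \<open>m\<close> of the strip for \<open>s = True\<close>, which fixes the parity.\<close>

lemma step_path_iterate_sigma2:
  assumes a: "a \<le> -3" and m: "m > 1" "m\<^sup>2 = - a * m - 1"
  shows "\<exists>p q. step_path (step_neg m (even n)) p ((dual_subst (sigma2 a) ^^ n) (dual_subst delta2 unit_chain)) q"
proof (induction n)
  case 0
  have "step_neg m True (pt 0 1) (signed True (frag_of (pt 0 1, 2))) (pt (0 + 1) 1)"
    by (rule step_neg.horizontal) (use m in \<open>simp add: strip_def\<close>)
  then show ?case by (auto simp: dual_subst_delta intro: step_path_single)
next
  case (Suc n)
  then show ?case using step_path_dual_subst_sigma2 [OF a m] by fastforce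
qed

text \<open>The two initial edges start at the closed ends 0 and \<open>m\<close> of their strips
  for \<open>s = True\<close>.\<close>

lemma step_path_iterate_sigma4:
  assumes a: "a \<le> -1" and m: "m > 1" "m\<^sup>2 = - a * m + 1"
  shows "\<exists>p q. step_path (edge_neg m (even n)) p ((dual_subst (sigma4 a) ^^ n) (dual_subst delta4 unit_chain)) q"
proof (induction n)
  case 0
  have "edge_neg m True (pt 0 0) (- signed True (frag_of (pt 0 0, 1))) (pt 0 (0 + 1))"
    by (rule edge_neg.vertical) (simp add: strip_def)
  moreover have "edge_neg m True (pt 0 (0 + 1)) (signed True (frag_of (pt 0 (0 + 1), 2))) (pt (0 + 1) (0 + 1))"
    by (rule edge_neg.horizontal) (use m in \<open>simp add: strip_def\<close>)
  ultimately have "step_path (edge_neg m True) (pt 0 0)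
      (- signed True (frag_of (pt 0 0, 1)) + signed True (frag_of (pt 0 (0 + 1), 2))) (pt (0 + 1) (0 + 1))"
    by (blast intro: step_path_append step_path_single)
  then show ?case by (auto simp: dual_subst_delta)
next
  case (Suc n)
  then show ?case using step_path_dual_subst_sigma4 [OF a m] by fastforce
qed

theorem theorem3:
  fixes a :: int and n :: nat
  assumes "n > 0"
  shows
    "(a \<ge> 3 \<longrightarrow>
       (dual_subst (sigma1 a) ^^ n) (dual_subst delta1 unit_chain) \<in> simple_chains (faces1 a)) \<and>
     (a \<le> -3 \<longrightarrow>
       (dual_subst (sigma2 a) ^^ (2 * n)) (dual_subst delta2 unit_chain)
         \<in> translate_chain (axis 1 1) ` simple_chains (faces2 a)) \<and>
     (a \<le> -1 \<longrightarrow>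
       (dual_subst (sigma4 a) ^^ (2 * n)) (dual_subst delta4 unit_chain)
         \<in> translate_chain (axis 1 1) ` simple_chains (faces4 a)) \<and>
     (a \<ge> 3 \<longrightarrow>
       connected_chain ((dual_subst (sigma1 a) ^^ n) (dual_subst delta1 unit_chain))) \<and>
     (a \<le> -3 \<longrightarrow>
       connected_chain ((dual_subst (sigma2 a) ^^ n) (dual_subst delta2 unit_chain))) \<and>
     (a \<le> -1 \<longrightarrow>
       connected_chain ((dual_subst (sigma4 a) ^^ n) (dual_subst delta4 unit_chain)))"
proof (intro conjI impI)
  assume a: "a \<ge> 3"
  obtain k where n: "n = Suc k" using assms by (cases n) auto
  note l = expanding_eigenvalue_sigma1 [OF a]
  obtain p q where "step_path (step_pos (expanding_eigenvalue (incidence_matrix (sigma1 a)))) p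
      ((dual_subst (sigma1 a) ^^ n) (dual_subst delta1 unit_chain)) q"
    unfolding n using step_path_iterate_sigma1 [OF a l(2,1)] by blast
  from step_pos_path_simple_connected [OF this]
  show "(dual_subst (sigma1 a) ^^ n) (dual_subst delta1 unit_chain) \<in> simple_chains (faces1 a)"
    and "connected_chain ((dual_subst (sigma1 a) ^^ n) (dual_subst delta1 unit_chain))"
    using l(2) by (simp_all add: faces1_def)
next
  assume a: "a \<le> -3"
  note m = expanding_eigenvalue_sigma2 [OF a]
  note path = step_path_iterate_sigma2 [OF a m(2,1)]
  show "(dual_subst (sigma2 a) ^^ (2 * n)) (dual_subst delta2 unit_chain)
      \<in> translate_chain (axis 1 1) ` simple_chains (faces2 a)"
    \<comment> \<open>An even index makes \<open>s\<close> true, as membership requires; corners are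
      first refined into edges.\<close>
    using path [of "2 * n"] step_path_edge_neg m(2) edge_neg_path_simple_connected(2)
    unfolding faces2_def by (metis dvd_triv_left less_imp_le)
  show "connected_chain ((dual_subst (sigma2 a) ^^ n) (dual_subst delta2 unit_chain))"
    using path [of n] step_path_edge_neg m(2) edge_neg_path_simple_connected(1) by (metis less_imp_le)
next
  assume a: "a \<le> -1"
  note m = expanding_eigenvalue_sigma4 [OF a]
  note path = step_path_iterate_sigma4 [OF a m(2,1)]
  show "(dual_subst (sigma4 a) ^^ (2 * n)) (dual_subst delta4 unit_chain)
      \<in> translate_chain (axis 1 1) ` simple_chains (faces4 a)"
    using path [of "2 * n"] edge_neg_path_simple_connected(2)
    unfolding faces4_def by (metis dvd_triv_left)
  show "connected_chain ((dual_subst (sigma4 a) ^^ n) (dual_subst delta4 unit_chain))"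
    using path [of n] edge_neg_path_simple_connected(1) by blast
qed

end
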